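(* Let $M_n$, for $n\in\mathbb{N}$, be structures in a common countable first-order language, and let $M=\prod_n M_n/\mathrm{Fin}$. If the complete theory of $M$ is stable, then $M$ is $\mathfrak c$-saturated, where $\mathfrak c=2^{\aleph_0}$. In particular, if $|M_n|\leq\mathfrak c$ for all $n$, then $M$ is saturated.
   Context: $\mathrm{Fin}$ is the ideal of finite subsets of $\mathbb{N}$. For an ideal $\mathcal I$ on a set $I$ and structures $M_i$ ($i\in I$) in the same language, the reduced product $\prod_i M_i/\mathcal I$ is the quotient of $\prod_i M_i$ by $(a_i)\sim(b_i)\iff\{i: a_i\neq b_i\}\in\mathcal I$, with function symbols interpreted coordinatewise modulo $\mathcal I$ and a relation $R$ holding of a tuple iff the set of coordinates where $R$ fails (for representatives) lies in $\mathcal I$. A type over $X\subseteq M$ is a consistent (not necessarily complete) set of formulas in one free variable with parameters from $X$. $M$ is $\kappa$-saturated if every type over every $X\subseteq M$ with $|X|<\kappa$ is realised in $M$; $M$ is saturated if it is $|M|$-saturated. A complete theory is stable if no formula $\varphi(\bar x,\bar y)$ has the order property, i.e. for no formula are there, for every $k$, tuples $\bar a_i,\bar b_i$ ($i<k$) in a model with $\varphi(\bar a_i,\bar b_j)$ iff $i\leq j$. *)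

theory Defs
  imports Main "HOL-Library.Countable_Set" "HOL-Library.FuncSet"
begin

unbundle cardinal_syntax

section \<open>First-order languages, structures and satisfaction\<close>

record ('f, 'r) language =
  funs :: "'f set"
  rels :: "'r set"
  fun_arity :: "'f \<Rightarrow> nat"
  rel_arity :: "'r \<Rightarrow> nat"

definition countable_language :: "('f, 'r) language \<Rightarrow> bool" where
  "countable_language L \<longleftrightarrow> countable (funs L) \<and> countable (rels L)"

record ('f, 'r, 'a) struct =
  univ :: "'a set"
  fun_in :: "'f \<Rightarrow> 'a list \<Rightarrow> 'a"
  rel_in :: "'r \<Rightarrow> 'a list \<Rightarrow> bool"

definition is_struct :: "('f, 'r) language \<Rightarrow> ('f, 'r, 'a) struct \<Rightarrow> bool" where
  "is_struct L M \<longleftrightarrow> univ M \<noteq> {} \<and>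
     (\<forall>f \<in> funs L. \<forall>xs. set xs \<subseteq> univ M \<and> length xs = fun_arity L f \<longrightarrow> fun_in M f xs \<in> univ M)"

text \<open>\<open>Par a\<close> is a parameter: a constant symbol naming the element \<open>a\<close> of the structure under
  consideration.  A formula of the language proper is one with \<open>fm_params \<phi> = {}\<close>.\<close>

datatype ('f, 'a) tm = Var nat | Par 'a | Fn 'f "('f, 'a) tm list"

datatype ('f, 'r, 'a) fm =
    Eq "('f, 'a) tm" "('f, 'a) tm"
  | Rel 'r "('f, 'a) tm list"
  | Neg "('f, 'r, 'a) fm"
  | And "('f, 'r, 'a) fm" "('f, 'r, 'a) fm"
  | Ex nat "('f, 'r, 'a) fm"

primrec tm_wf :: "('f, 'r) language \<Rightarrow> ('f, 'a) tm \<Rightarrow> bool" where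
  "tm_wf L (Var n) \<longleftrightarrow> True"
| "tm_wf L (Par a) \<longleftrightarrow> True"
| "tm_wf L (Fn f ts) \<longleftrightarrow> f \<in> funs L \<and> length ts = fun_arity L f \<and> list_all id (map (tm_wf L) ts)"

primrec fm_wf :: "('f, 'r) language \<Rightarrow> ('f, 'r, 'a) fm \<Rightarrow> bool" where
  "fm_wf L (Eq s t) \<longleftrightarrow> tm_wf L s \<and> tm_wf L t"
| "fm_wf L (Rel r ts) \<longleftrightarrow> r \<in> rels L \<and> length ts = rel_arity L r \<and> list_all (tm_wf L) ts"
| "fm_wf L (Neg \<phi>) \<longleftrightarrow> fm_wf L \<phi>"
| "fm_wf L (And \<phi> \<psi>) \<longleftrightarrow> fm_wf L \<phi> \<and> fm_wf L \<psi>"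
| "fm_wf L (Ex n \<phi>) \<longleftrightarrow> fm_wf L \<phi>"

primrec tm_vars :: "('f, 'a) tm \<Rightarrow> nat set" where
  "tm_vars (Var n) = {n}"
| "tm_vars (Par a) = {}"
| "tm_vars (Fn f ts) = \<Union> (set (map tm_vars ts))"

primrec fm_vars :: "('f, 'r, 'a) fm \<Rightarrow> nat set" \<comment> \<open>free variables\<close> where
  "fm_vars (Eq s t) = tm_vars s \<union> tm_vars t"
| "fm_vars (Rel r ts) = \<Union> (set (map tm_vars ts))"
| "fm_vars (Neg \<phi>) = fm_vars \<phi>"
| "fm_vars (And \<phi> \<psi>) = fm_vars \<phi> \<union> fm_vars \<psi>"
| "fm_vars (Ex n \<phi>) = fm_vars \<phi> - {n}"

primrec tm_params :: "('f, 'a) tm \<Rightarrow> 'a set" where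
  "tm_params (Var n) = {}"
| "tm_params (Par a) = {a}"
| "tm_params (Fn f ts) = \<Union> (set (map tm_params ts))"

primrec fm_params :: "('f, 'r, 'a) fm \<Rightarrow> 'a set" where
  "fm_params (Eq s t) = tm_params s \<union> tm_params t"
| "fm_params (Rel r ts) = \<Union> (set (map tm_params ts))"
| "fm_params (Neg \<phi>) = fm_params \<phi>"
| "fm_params (And \<phi> \<psi>) = fm_params \<phi> \<union> fm_params \<psi>"
| "fm_params (Ex n \<phi>) = fm_params \<phi>"

primrec tm_val :: "('f, 'r, 'a) struct \<Rightarrow> (nat \<Rightarrow> 'a) \<Rightarrow> ('f, 'a) tm \<Rightarrow> 'a" where
  "tm_val M e (Var n) = e n"
| "tm_val M e (Par a) = a"
| "tm_val M e (Fn f ts) = fun_in M f (map (tm_val M e) ts)"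

primrec sat :: "('f, 'r, 'a) struct \<Rightarrow> (nat \<Rightarrow> 'a) \<Rightarrow> ('f, 'r, 'a) fm \<Rightarrow> bool" where
  "sat M e (Eq s t) \<longleftrightarrow> tm_val M e s = tm_val M e t"
| "sat M e (Rel r ts) \<longleftrightarrow> rel_in M r (map (tm_val M e) ts)"
| "sat M e (Neg \<phi>) \<longleftrightarrow> \<not> sat M e \<phi>"
| "sat M e (And \<phi> \<psi>) \<longleftrightarrow> sat M e \<phi> \<and> sat M e \<psi>"
| "sat M e (Ex n \<phi>) \<longleftrightarrow> (\<exists>a \<in> univ M. sat M (e(n := a)) \<phi>)"

definition holds :: "('f, 'r, 'a) struct \<Rightarrow> ('f, 'r, 'a) fm \<Rightarrow> bool" where
  "holds M \<phi> \<longleftrightarrow> (\<forall>e. range e \<subseteq> univ M \<longrightarrow> sat M e \<phi>)"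


section \<open>Complete theories and stability\<close>

definition Th :: "('f, 'r) language \<Rightarrow> ('f, 'r, 'a) struct \<Rightarrow> ('f, 'r, 'a) fm set" where
  "Th L M = {\<phi>. fm_wf L \<phi> \<and> fm_params \<phi> = {} \<and> fm_vars \<phi> = {} \<and> holds M \<phi>}"

definition is_model :: "('f, 'r) language \<Rightarrow> ('f, 'r, 'a) fm set \<Rightarrow> ('f, 'r, 'a) struct \<Rightarrow> bool" where
  "is_model L T N \<longleftrightarrow> is_struct L N \<and> (\<forall>\<phi> \<in> T. holds N \<phi>)"

text \<open>The formula is \<open>\<phi>(x\<^sub>0,\<dots>,x\<^sub>m\<^sub>-\<^sub>1; y\<^sub>0,\<dots>,y\<^sub>n\<^sub>-\<^sub>1)\<close>, with \<open>x\<^sub>i\<close> the variable \<open>i\<close> and \<open>y\<^sub>j\<close> the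
  variable \<open>m + j\<close>.  Models range over structures with elements of type \<open>'a\<close>.  For
  \<open>T = Th L M\<close> this is no restriction: \<open>M\<close> is such a model, and for each \<open>k\<close> the existence of
  the tuples is expressed by a sentence, so it has the same truth value in all models of \<open>T\<close>.\<close>

definition order_property ::
    "('f, 'r) language \<Rightarrow> ('f, 'r, 'a) fm set \<Rightarrow> nat \<Rightarrow> nat \<Rightarrow> ('f, 'r, 'a) fm \<Rightarrow> bool" where
  "order_property L T m n \<phi> \<longleftrightarrow>
     (\<forall>k::nat. \<exists>N. is_model L T N \<and>
        (\<exists>a b :: nat \<Rightarrow> 'a list.
           (\<forall>i<k. length (a i) = m \<and> set (a i) \<subseteq> univ N \<and> length (b i) = n \<and> set (b i) \<subseteq> univ N) \<and>
           (\<forall>i<k. \<forall>j<k. sat N ((!) (a i @ b j)) \<phi> \<longleftrightarrow> i \<le> j)))"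

definition stable :: "('f, 'r) language \<Rightarrow> ('f, 'r, 'a) fm set \<Rightarrow> bool" where
  "stable L T \<longleftrightarrow>
     \<not> (\<exists>m n \<phi>. fm_wf L \<phi> \<and> fm_params \<phi> = {} \<and> fm_vars \<phi> \<subseteq> {..<m + n} \<and> order_property L T m n \<phi>)"


section \<open>Types and saturation\<close>

definition realises :: "('f, 'r, 'a) struct \<Rightarrow> 'a \<Rightarrow> ('f, 'r, 'a) fm set \<Rightarrow> bool" where
  "realises M a p \<longleftrightarrow> a \<in> univ M \<and> (\<forall>\<phi> \<in> p. sat M (\<lambda>_. a) \<phi>)"

text \<open>Consistency is consistency with the complete theory of \<open>M\<close> with names for the elements of
  \<open>X\<close>.  That theory decides each sentence \<open>\<exists>x. \<phi>\<^sub>1 \<and> \<dots> \<and> \<phi>\<^sub>k\<close> with \<open>\<phi>\<^sub>i \<in> p\<close>, so \<open>p\<close> is consistent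
  with it iff all these sentences hold in \<open>M\<close>.\<close>

definition is_type :: "('f, 'r) language \<Rightarrow> ('f, 'r, 'a) struct \<Rightarrow> 'a set \<Rightarrow> ('f, 'r, 'a) fm set \<Rightarrow> bool" where
  "is_type L M X p \<longleftrightarrow>
     (\<forall>\<phi> \<in> p. fm_wf L \<phi> \<and> fm_params \<phi> \<subseteq> X \<and> fm_vars \<phi> \<subseteq> {0}) \<and>
     (\<forall>q. finite q \<and> q \<subseteq> p \<longrightarrow> (\<exists>a. realises M a q))"

text \<open>A set of formulas realised in some model, over any type of elements, of the complete theory
  of \<open>M\<close> with names for the elements of \<open>X\<close> is a type; \<open>h\<close> interprets these names.\<close>

lemma tm_val_cong:
  "(\<And>n. n \<in> tm_vars t \<Longrightarrow> e n = e' n) \<Longrightarrow> tm_val M e t = tm_val M e' t"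
proof (induction t)
  case (Fn f ts)
  have "tm_val M e t = tm_val M e' t" if "t \<in> set ts" for t
    by (rule Fn.IH[OF that]) (use Fn.prems that in auto)
  then have "map (tm_val M e) ts = map (tm_val M e') ts" by simp
  then show ?case by (simp del: map_eq_conv)
qed auto

lemma sat_cong:
  "(\<And>n. n \<in> fm_vars \<phi> \<Longrightarrow> e n = e' n) \<Longrightarrow> sat M e \<phi> \<longleftrightarrow> sat M e' \<phi>"
proof (induction \<phi> arbitrary: e e')
  case (Eq s t)
  then have "tm_val M e s = tm_val M e' s" "tm_val M e t = tm_val M e' t"
    by (auto intro!: tm_val_cong)
  then show ?case by simp
next
  case (Rel r ts)
  then have "map (tm_val M e) ts = map (tm_val M e') ts"
    by (auto intro!: tm_val_cong)
  then show ?case by (simp del: map_eq_conv)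
next
  case (Neg \<phi>)
  then show ?case by (metis fm_vars.simps(3) sat.simps(3))
next
  case (And \<phi> \<psi>)
  then show ?case by (metis UnCI fm_vars.simps(4) sat.simps(4))
next
  case (Ex n \<phi>)
  have "sat M (e(n := a)) \<phi> \<longleftrightarrow> sat M (e'(n := a)) \<phi>" for a
    by (rule Ex.IH) (use Ex.prems in auto)
  then show ?case by simp
qed

lemma is_type_if_realised_in_model:
  fixes N :: "('f, 'r, 'b) struct" and h :: "'a \<Rightarrow> 'b"
  assumes p: "\<And>\<phi>. \<phi> \<in> p \<Longrightarrow> fm_wf L \<phi> \<and> fm_params \<phi> \<subseteq> X \<and> fm_vars \<phi> \<subseteq> {0}"
    and N: "\<And>\<psi>. fm_wf L \<psi> \<Longrightarrow> fm_params \<psi> \<subseteq> X \<Longrightarrow> fm_vars \<psi> = {} \<Longrightarrow> holds M \<psi> \<Longrightarrow>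
      holds N (map_fm id id h \<psi>)"
    and b: "realises N b (map_fm id id h ` p)"
  shows "is_type L M X p"
  unfolding is_type_def
proof (intro conjI allI impI)
  show "\<forall>\<phi> \<in> p. fm_wf L \<phi> \<and> fm_params \<phi> \<subseteq> X \<and> fm_vars \<phi> \<subseteq> {0}" using p by blast
next
  fix q assume q: "finite q \<and> q \<subseteq> p"
  then obtain \<phi>s where \<phi>s: "set \<phi>s = q" using finite_list by blast
  define c where "c = foldr And \<phi>s (Eq (Var 0) (Var 0))"
  have "\<forall>\<phi> \<in> set \<phi>s. fm_wf L \<phi> \<and> fm_params \<phi> \<subseteq> X \<and> fm_vars \<phi> \<subseteq> {0}"
    using q p \<phi>s by blast
  then have c: "fm_wf L c \<and> fm_params c \<subseteq> X \<and> fm_vars c \<subseteq> {0}"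
    unfolding c_def by (induction \<phi>s) simp_all
  have satM: "sat M e c \<longleftrightarrow> (\<forall>\<phi> \<in> q. sat M e \<phi>)" for e
    unfolding c_def \<phi>s[symmetric] by (induction \<phi>s) auto
  have satN: "sat N e (map_fm id id h c) \<longleftrightarrow> (\<forall>\<phi> \<in> q. sat N e (map_fm id id h \<phi>))" for e
    unfolding c_def \<phi>s[symmetric] by (induction \<phi>s) auto
  show "\<exists>a. realises M a q"
  proof (rule ccontr)
    assume none: "\<nexists>a. realises M a q"
    have "\<not> sat M (e(0 := a)) c" if "a \<in> univ M" for e a
    proof -
      have "sat M (e(0 := a)) c \<longleftrightarrow> sat M (\<lambda>_. a) c"
        by (rule sat_cong) (use c in auto)
      then show ?thesis using none that by (auto simp: realises_def satM)
    qed
    then have "holds M (Neg (Ex 0 c))" by (simp add: holds_def)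
    then have "holds N (map_fm id id h (Neg (Ex 0 c)))"
      using c by (intro N) auto
    moreover have "b \<in> univ N" using b by (simp add: realises_def)
    ultimately have "\<not> sat N ((\<lambda>_. b)(0 := b)) (map_fm id id h c)"
      unfolding holds_def by fastforce
    moreover have "(\<lambda>_. b)(0 := b) = (\<lambda>_::nat. b)" by auto
    ultimately show False using b q by (auto simp: realises_def satN)
  qed
qed

definition card_saturated :: "('f, 'r) language \<Rightarrow> 'k rel \<Rightarrow> ('f, 'r, 'a) struct \<Rightarrow> bool" where
  "card_saturated L \<kappa> M \<longleftrightarrow>
     (\<forall>X p. X \<subseteq> univ M \<and> |X| <o \<kappa> \<and> is_type L M X p \<longrightarrow> (\<exists>a. realises M a p))"

definition saturated :: "('f, 'r) language \<Rightarrow> ('f, 'r, 'a) struct \<Rightarrow> bool" where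
  "saturated L M \<longleftrightarrow> card_saturated L |univ M| M"

abbreviation continuum :: "(nat \<Rightarrow> bool) rel" where
  "continuum \<equiv> ctwo ^c natLeq"


section \<open>Reduced products\<close>

definition Fin :: "nat set set" where
  "Fin = {A. finite A}"

definition prod_univ :: "('i \<Rightarrow> ('f, 'r, 'a) struct) \<Rightarrow> ('i \<Rightarrow> 'a) set" where
  "prod_univ M = (\<Pi> i \<in> UNIV. univ (M i))"

definition eq_mod :: "'i set set \<Rightarrow> ('i \<Rightarrow> ('f, 'r, 'a) struct) \<Rightarrow> ('i \<Rightarrow> 'a) rel" where
  "eq_mod \<I> M = {(a, b). a \<in> prod_univ M \<and> b \<in> prod_univ M \<and> {i. a i \<noteq> b i} \<in> \<I>}"

definition rep :: "('i \<Rightarrow> 'a) set \<Rightarrow> 'i \<Rightarrow> 'a" where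
  "rep c = (SOME a. a \<in> c)"

definition reduced_product ::
    "'i set set \<Rightarrow> ('i \<Rightarrow> ('f, 'r, 'a) struct) \<Rightarrow> ('f, 'r, ('i \<Rightarrow> 'a) set) struct" where
  "reduced_product \<I> M = \<lparr>
     univ = prod_univ M // eq_mod \<I> M,
     fun_in = (\<lambda>f cs. eq_mod \<I> M `` {\<lambda>i. fun_in (M i) f (map (\<lambda>c. rep c i) cs)}),
     rel_in = (\<lambda>r cs. {i. \<not> rel_in (M i) r (map (\<lambda>c. rep c i) cs)} \<in> \<I>)\<rparr>"

definition is_ideal :: "'i set set \<Rightarrow> bool" where
  "is_ideal \<I> \<longleftrightarrow> {} \<in> \<I> \<and> (\<forall>A \<in> \<I>. \<forall>B \<subseteq> A. B \<in> \<I>) \<and> (\<forall>A \<in> \<I>. \<forall>B \<in> \<I>. A \<union> B \<in> \<I>)"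

lemma is_ideal_Fin: "is_ideal Fin"
  unfolding is_ideal_def Fin_def by (auto intro: finite_subset)

lemma equiv_eq_mod:
  assumes "is_ideal \<I>"
  shows "equiv (prod_univ M) (eq_mod \<I> M)"
proof (rule equivI)
  show "eq_mod \<I> M \<subseteq> prod_univ M \<times> prod_univ M"
    by (auto simp: eq_mod_def)
  show "refl_on (prod_univ M) (eq_mod \<I> M)"
    using assms by (auto simp: refl_on_def eq_mod_def is_ideal_def)
  show "sym (eq_mod \<I> M)"
    by (auto simp: sym_def eq_mod_def eq_commute)
  show "trans (eq_mod \<I> M)"
  proof (rule transI)
    fix a b c assume ab: "(a, b) \<in> eq_mod \<I> M" and bc: "(b, c) \<in> eq_mod \<I> M"
    then have "{i. a i \<noteq> b i} \<union> {i. b i \<noteq> c i} \<in> \<I>"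
      using assms by (auto simp: eq_mod_def is_ideal_def)
    moreover have "{i. a i \<noteq> c i} \<subseteq> {i. a i \<noteq> b i} \<union> {i. b i \<noteq> c i}" by auto
    ultimately have "{i. a i \<noteq> c i} \<in> \<I>"
      using assms unfolding is_ideal_def by blast
    then show "(a, c) \<in> eq_mod \<I> M" using ab bc by (auto simp: eq_mod_def)
  qed
qed

lemma rep_in_class:
  assumes "is_ideal \<I>" and "a \<in> prod_univ M"
  shows "rep (eq_mod \<I> M `` {a}) \<in> eq_mod \<I> M `` {a}"
  using equiv_class_self[OF equiv_eq_mod[OF assms(1)] assms(2)]
  unfolding rep_def by (metis someI)

lemma reps_differ_in_ideal:
  assumes I: "is_ideal \<I>" and "set as \<subseteq> prod_univ M"
  shows "{i. map (\<lambda>c. rep c i) (map (\<lambda>a. eq_mod \<I> M `` {a}) as) \<noteq> map (\<lambda>a. a i) as} \<in> \<I>"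
  using assms(2)
proof (induction as)
  case Nil
  then show ?case using I by (auto simp: is_ideal_def)
next
  case (Cons a as)
  let ?D = "{i. map (\<lambda>c. rep c i) (map (\<lambda>a. eq_mod \<I> M `` {a}) as) \<noteq> map (\<lambda>a. a i) as}"
  have "rep (eq_mod \<I> M `` {a}) \<in> eq_mod \<I> M `` {a}"
    using rep_in_class[OF I] Cons.prems by auto
  then have "{i. a i \<noteq> rep (eq_mod \<I> M `` {a}) i} \<in> \<I>"
    by (auto simp: eq_mod_def)
  moreover have "?D \<in> \<I>" using Cons by auto
  ultimately have "{i. a i \<noteq> rep (eq_mod \<I> M `` {a}) i} \<union> ?D \<in> \<I>"
    using I by (simp add: is_ideal_def)
  then show ?case
    by (rule subst[rotated, where P = "\<lambda>S. S \<in> \<I>"]) auto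
qed

text \<open>The interpretations do not depend on the representatives chosen by \<open>rep\<close>.\<close>

lemma rel_in_reduced_product:
  assumes I: "is_ideal \<I>" and as: "set as \<subseteq> prod_univ M"
  shows "rel_in (reduced_product \<I> M) r (map (\<lambda>a. eq_mod \<I> M `` {a}) as) \<longleftrightarrow>
         {i. \<not> rel_in (M i) r (map (\<lambda>a. a i) as)} \<in> \<I>"
    (is "?lhs \<longleftrightarrow> ?B \<in> \<I>")
proof -
  let ?A = "{i. \<not> rel_in (M i) r (map (\<lambda>c. rep c i) (map (\<lambda>a. eq_mod \<I> M `` {a}) as))}"
  let ?D = "{i. map (\<lambda>c. rep c i) (map (\<lambda>a. eq_mod \<I> M `` {a}) as) \<noteq> map (\<lambda>a. a i) as}"
  have D: "?D \<in> \<I>" by (rule reps_differ_in_ideal[OF I as])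
  have "?A \<subseteq> ?B \<union> ?D" "?B \<subseteq> ?A \<union> ?D" by (auto simp del: map_map)
  then have "?A \<in> \<I> \<longleftrightarrow> ?B \<in> \<I>"
    using I D unfolding is_ideal_def by meson
  then show ?thesis by (simp add: reduced_product_def)
qed

lemma fun_in_reduced_product:
  assumes I: "is_ideal \<I>" and M: "\<And>i. is_struct L (M i)" and f: "f \<in> funs L"
    and as: "set as \<subseteq> prod_univ M" and len: "length as = fun_arity L f"
  shows "fun_in (reduced_product \<I> M) f (map (\<lambda>a. eq_mod \<I> M `` {a}) as) =
         eq_mod \<I> M `` {\<lambda>i. fun_in (M i) f (map (\<lambda>a. a i) as)}"
proof -
  let ?cs = "map (\<lambda>a. eq_mod \<I> M `` {a}) as"
  let ?g = "\<lambda>i. fun_in (M i) f (map (\<lambda>c. rep c i) ?cs)"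
  let ?h = "\<lambda>i. fun_in (M i) f (map (\<lambda>a. a i) as)"
  let ?D = "{i. map (\<lambda>c. rep c i) ?cs \<noteq> map (\<lambda>a. a i) as}"
  have rep: "rep (eq_mod \<I> M `` {a}) \<in> prod_univ M" if "a \<in> set as" for a
    using rep_in_class[OF I, of a M] as that by (auto simp: eq_mod_def)
  have "?g \<in> prod_univ M"
    unfolding prod_univ_def
  proof (intro Pi_I)
    fix i
    have "set (map (\<lambda>c. rep c i) ?cs) \<subseteq> univ (M i)"
      using rep by (auto simp: prod_univ_def)
    then show "?g i \<in> univ (M i)"
      using M[of i] f len unfolding is_struct_def by (metis length_map)
  qed
  moreover have "?h \<in> prod_univ M"
    unfolding prod_univ_def
  proof (intro Pi_I)
    fix i
    have "set (map (\<lambda>a. a i) as) \<subseteq> univ (M i)"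
      using as by (auto simp: prod_univ_def)
    then show "?h i \<in> univ (M i)"
      using M[of i] f len unfolding is_struct_def by (metis length_map)
  qed
  moreover have "{i. ?g i \<noteq> ?h i} \<in> \<I>"
  proof -
    have "{i. ?g i \<noteq> ?h i} \<subseteq> ?D" by (auto simp del: map_map map_eq_conv)
    then show ?thesis
      using reps_differ_in_ideal[OF I as] I unfolding is_ideal_def by meson
  qed
  ultimately have "(?g, ?h) \<in> eq_mod \<I> M" by (simp add: eq_mod_def)
  then have "eq_mod \<I> M `` {?g} = eq_mod \<I> M `` {?h}"
    by (rule equiv_class_eq[OF equiv_eq_mod[OF I]])
  then show ?thesis by (simp add: reduced_product_def)
qed

end

theory Submission
  imports Defs "HOL-Library.Countable_Set_Type"
begin

text \<open>
  Palyutin's h-formulas are obtained from atomic formulas by conjunction, \<open>\<exists>\<close> and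
  \<open>\<exists>x \<phi> \<and> \<forall>x (\<phi> \<longrightarrow> \<psi>)\<close>.  An h-formula holds in \<open>\<Prod>M\<^sub>n/Fin\<close> iff it holds in almost all \<open>M\<^sub>n\<close>.
  Solutions of \<open>\<phi> \<and> \<not>\<psi>\<^sub>1, \<dots>, \<phi> \<and> \<not>\<psi>\<^sub>k\<close> can be patched together on disjoint infinite sets of
  coordinates, so every formula is equivalent to a Boolean combination of h-formulas.  Patching also
  shows that an h-formula has the order property unless it is normal: two sets \<open>\<chi>(M, a)\<close> and
  \<open>\<chi>(M, b)\<close> are equal or disjoint.

  If all h-formulas are normal, then the positive part of a type is given by countably many
  instances.  Diagonalising along the coordinates yields a family, indexed by \<open>2\<^sup>\<omega>\<close>, of realisations of
  the positive part, no two of which satisfy a common instance of any h-formula not decided by the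
  positive part.  Fewer than continuum many negated instances cannot exclude all of them.
\<close>

section \<open>Ultrafilters, selections and cardinalities\<close>

text \<open>Zorn's lemma yields a maximal family with the finite intersection property. It later
  serves to complete a type: it decides every set of elements of the product, hence every instance
  of every formula.\<close>

lemma finite_intersections_extend_to_ultrafilter:
  fixes F :: "'x set set"
  assumes F: "\<And>Q. finite Q \<Longrightarrow> Q \<subseteq> F \<Longrightarrow> \<Inter>Q \<noteq> {}"
  shows "\<exists>U. F \<subseteq> U \<and> (\<forall>Q. finite Q \<and> Q \<subseteq> U \<longrightarrow> \<Inter>Q \<noteq> {}) \<and> (\<forall>B. B \<in> U \<or> - B \<in> U)"
proof -
  define fip where "fip U \<longleftrightarrow> (\<forall>Q. finite Q \<and> Q \<subseteq> U \<longrightarrow> \<Inter>Q \<noteq> {})" for U :: "'x set set"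
  define \<A> where "\<A> = {U. F \<subseteq> U \<and> fip U}"
  have "\<exists>U\<in>\<A>. \<forall>V\<in>\<A>. U \<subseteq> V \<longrightarrow> V = U"
  proof (rule subset_Zorn_nonempty)
    have "F \<in> \<A>" using F by (simp add: \<A>_def fip_def)
    then show "\<A> \<noteq> {}" by blast
  next
    fix \<C> assume ne: "\<C> \<noteq> {}" and chain: "subset.chain \<A> \<C>"
    then have \<C>: "F \<subseteq> C \<and> fip C" if "C \<in> \<C>" for C
      using that by (auto simp: subset.chain_def \<A>_def)
    have "\<Inter>Q \<noteq> {}" if Q: "finite Q" "Q \<subseteq> \<Union>\<C>" for Q
    proof -
      obtain C where "C \<in> \<C>" "Q \<subseteq> C"
        by (rule finite_subset_Union_chain[OF Q ne chain])
      then show ?thesis using \<C>[of C] Q(1) by (simp add: fip_def)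
    qed
    then have "fip (\<Union>\<C>)" by (simp add: fip_def)
    moreover have "F \<subseteq> \<Union>\<C>" using ne \<C> by blast
    ultimately show "\<Union>\<C> \<in> \<A>" by (simp add: \<A>_def)
  qed
  then obtain U where U: "F \<subseteq> U" "fip U" and max: "\<And>V. V \<in> \<A> \<Longrightarrow> U \<subseteq> V \<Longrightarrow> V = U"
    by (auto simp: \<A>_def)
  \<comment> \<open>Maximality: a set outside \<open>U\<close> cannot be added, so it misses some
    finite intersection of members of \<open>U\<close>.\<close>
  have refuted: "\<exists>Q. finite Q \<and> Q \<subseteq> U \<and> \<Inter>Q \<inter> B = {}" if "B \<notin> U" for B
  proof (rule ccontr)
    assume none: "\<not> ?thesis"
    have "\<Inter>Q \<noteq> {}" if Q: "finite Q" "Q \<subseteq> insert B U" for Q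
    proof -
      have "finite (Q - {B})" "Q - {B} \<subseteq> U" using Q by auto
      then have "\<Inter>(Q - {B}) \<inter> B \<noteq> {}" using none by metis
      moreover have "\<Inter>(Q - {B}) \<inter> B \<subseteq> \<Inter>Q" by auto
      ultimately show ?thesis by (metis subset_empty)
    qed
    then have "insert B U \<in> \<A>" using U(1) by (auto simp: \<A>_def fip_def)
    then show False using max[of "insert B U"] that by blast
  qed
  have ultra: "B \<in> U \<or> - B \<in> U" for B
  proof (rule ccontr)
    assume "\<not> ?thesis"
    then obtain Q Q' where Q: "finite Q" "Q \<subseteq> U" "\<Inter>Q \<inter> B = {}"
      and Q': "finite Q'" "Q' \<subseteq> U" "\<Inter>Q' \<inter> - B = {}"
      using refuted[of B] refuted[of "- B"] by metis
    have "\<Inter>(Q \<union> Q') = {}"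
    proof -
      have "X \<inter> Y = {}" if "X \<inter> B = {}" "Y \<inter> - B = {}" for X Y using that by blast
      then show ?thesis using Q(3) Q'(3) by (simp only: Inter_Un_distrib)
    qed
    moreover have "finite (Q \<union> Q')" "Q \<union> Q' \<subseteq> U" using Q Q' by simp_all
    ultimately show False using U(2) by (simp only: fip_def)
  qed
  show ?thesis
    using U ultra unfolding fip_def by (intro exI[of _ U] conjI) simp_all
qed

section \<open>Selection of disjoint infinite sets of coordinates\<close>

lemma strict_mono_selection:
  fixes P :: "nat \<Rightarrow> nat \<Rightarrow> bool"
  assumes "\<And>i. INFM n. P i n"
  obtains r where "strict_mono r" "\<And>i. P i (r i)"
proof -
  have "\<exists>r. \<forall>i. P i (r i) \<and> r i < r (Suc i)"
  proof (rule dependent_nat_choice)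
    show "\<exists>n. P 0 n" using INFM_EX[OF assms] .
    show "\<exists>n'. P (Suc i) n' \<and> n < n'" if "P i n" for n i
      using assms[of "Suc i"] unfolding INFM_nat by blast
  qed
  then obtain r where "\<forall>i. P i (r i) \<and> r i < r (Suc i)" ..
  then show ?thesis by (intro that[of r]) (simp_all add: strict_mono_Suc_iff)
qed

text \<open>Run through \<open>K\<close> so that each member recurs infinitely often, and serve it
  each time at a coordinate beyond all earlier ones. \<open>lab\<close> records who is served at a
  coordinate and \<open>st\<close> at which step. Each step uses one coordinate, so
  \<open>st\<close> tends to infinity along the labelled coordinates; elsewhere it carries no
  information.\<close>

lemma staged_disjoint_selection:
  fixes P :: "'k \<Rightarrow> nat \<Rightarrow> nat \<Rightarrow> bool"
  assumes "countable K" and inf: "\<And>k s. k \<in> K \<Longrightarrow> INFM n. P k s n"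
  obtains lab :: "nat \<Rightarrow> 'k option" and st :: "nat \<Rightarrow> nat" where
    "\<And>n k. lab n = Some k \<Longrightarrow> k \<in> K \<and> P k (st n) n"
    "\<And>s. MOST n. lab n \<noteq> None \<longrightarrow> s \<le> st n"
    "\<And>k. k \<in> K \<Longrightarrow> INFM n. lab n = Some k"
proof (cases "K = {}")
  case True
  then show ?thesis by (intro that[of "\<lambda>_. None" "\<lambda>_. 0"]) auto
next
  case False
  \<comment> \<open>The second component of the decoded pair is free, so every member of
    \<open>K\<close> is taken infinitely often.\<close>
  define \<kappa> where "\<kappa> i = from_nat_into K (fst (prod_decode i))" for i
  have \<kappa>: "\<kappa> i \<in> K" for i using False by (simp add: \<kappa>_def from_nat_into)
  obtain r where r: "strict_mono r" "\<And>i. P (\<kappa> i) i (r i)"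
    by (rule strict_mono_selection[of "\<lambda>i. P (\<kappa> i) i", OF inf[OF \<kappa>]]) blast
  then have inj: "inj r" by (simp add: strict_mono_imp_inj_on)
  define lab where "lab n = (if n \<in> range r then Some (\<kappa> (inv r n)) else None)" for n
  show ?thesis
  proof (rule that[of lab "inv r"])
    show "k \<in> K \<and> P k (inv r n) n" if "lab n = Some k" for n k
      using that \<kappa> r(2) inj by (auto simp: lab_def split: if_splits)
    show "MOST n. lab n \<noteq> None \<longrightarrow> s \<le> inv r n" for s
    proof -
      have "{n. \<not> (lab n \<noteq> None \<longrightarrow> s \<le> inv r n)} \<subseteq> r ` {..<s}"
        using inj by (auto simp: lab_def split: if_splits)
      then show ?thesis unfolding MOST_iff_cofinite by (rule finite_subset) simp
    qed
    show "INFM n. lab n = Some k" if k: "k \<in> K" for k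
    proof -
      obtain j where j: "from_nat_into K j = k"
        using from_nat_into_surj[OF \<open>countable K\<close> k] ..
      have "lab (r (prod_encode (j, t))) = Some k" for t
        using inj j by (simp add: lab_def \<kappa>_def)
      moreover have "inj (\<lambda>t. r (prod_encode (j, t)))"
        by (auto intro!: injI dest: injD[OF inj])
      ultimately show ?thesis
        by (intro INFM_inj[of "\<lambda>n. lab n = Some k" "\<lambda>t. r (prod_encode (j, t))"]) simp_all
    qed
  qed
qed

section \<open>Cardinalities below the continuum\<close>

lemma continuum_ordIso: "continuum =o |UNIV :: (nat \<Rightarrow> bool) set|"
  using card_of_Func_UNIV[where ?'a = nat and B = "UNIV :: bool set"]
  by (simp add: cexp_def ctwo_def Field_natLeq Field_card_of)

lemma countable_ordLess_continuum:
  assumes "countable A"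
  shows "|A| <o continuum"
  using assms unfolding countable_card_le_natLeq
  by (rule ordLeq_ordLess_trans[OF _ ordLess_ctwo_cexp[OF natLeq_Card_order]])

lemma card_of_Times_ordLeq_infinite:
  assumes "infinite X" "|A| \<le>o |X|" "|B| \<le>o |X|"
  shows "|A \<times> B| \<le>o |X|"
  by (rule card_of_Times_ordLeq_infinite_Field[OF _ assms(2,3) card_of_Card_order])
    (simp add: Field_card_of assms(1))

lemma card_of_lists_infinite_ordLeq:
  assumes inf: "infinite X"
  shows "|lists X| \<le>o |X|"
proof -
  define S where "S n = {l \<in> lists X. length l = n}" for n
  have "|S n| \<le>o |X|" for n
  proof (induction n)
    case 0
    obtain x where "x \<in> X" using infinite_imp_nonempty[OF inf] by blast
    moreover have "S 0 \<subseteq> {[]}" by (simp add: S_def subset_iff)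
    ultimately have "S 0 \<subseteq> (\<lambda>_. []) ` X" by blast
    then show ?case by (rule surj_imp_ordLeq)
  next
    case (Suc n)
    have "S (Suc n) \<subseteq> (\<lambda>(x, l). x # l) ` (X \<times> S n)"
    proof
      fix l assume "l \<in> S (Suc n)"
      then show "l \<in> (\<lambda>(x, l). x # l) ` (X \<times> S n)"
        by (cases l) (simp_all add: S_def image_iff)
    qed
    then have "|S (Suc n)| \<le>o |X \<times> S n|" by (rule surj_imp_ordLeq)
    also have "|X \<times> S n| \<le>o |X|"
      by (rule card_of_Times_ordLeq_infinite[OF inf ordLeq_refl[OF card_of_Card_order] Suc])
    finally show ?case .
  qed
  moreover have "|UNIV :: nat set| \<le>o |X|"
    using inf by (simp only: infinite_iff_card_of_nat)
  ultimately have "|\<Union>n. S n| \<le>o |X|"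
    by (intro card_of_UNION_ordLeq_infinite[OF inf]) simp_all
  moreover have "(\<Union>n. S n) = lists X" by (simp add: S_def set_eq_iff)
  ultimately show ?thesis by simp
qed

text \<open>This bounds the number of instances of countably many formulas with parameters from
  \<open>X\<close>. For finite \<open>X\<close> there may still be infinitely many lists, whence the
  case split.\<close>

lemma card_of_countable_Times_lists_ordLess_continuum:
  assumes "countable H" and X: "|X| <o continuum"
  shows "|H \<times> lists X| <o continuum"
proof (cases "finite X")
  case True
  then show ?thesis using assms by (intro countable_ordLess_continuum) (simp add: countable_finite)
next
  case False
  have "|H| \<le>o |X|"
    using assms(1) False unfolding countable_card_of_nat infinite_iff_card_of_nat
    by (rule ordLeq_transitive)
  then have "|H \<times> lists X| \<le>o |X|"
    by (rule card_of_Times_ordLeq_infinite[OF False _ card_of_lists_infinite_ordLeq[OF False]])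
  then show ?thesis using X by (rule ordLeq_ordLess_trans)
qed

section \<open>Realising normal predicates\<close>

text \<open>\<open>Q \<psi> n \<beta> c\<close> plays the role of \<open>M\<^sub>n \<Turnstile> \<psi>(c, \<beta>)\<close>.  Normality says that two sets
  \<open>\<psi>(M\<^sub>n, \<beta>)\<close> and \<open>\<psi>(M\<^sub>n, \<gamma>)\<close> are equal or disjoint.\<close>

lemma realise_normal_predicates:
  fixes Q :: "'h \<Rightarrow> nat \<Rightarrow> 'b \<Rightarrow> 'a \<Rightarrow> bool" and A :: "nat \<Rightarrow> 'a set" and B :: "nat \<Rightarrow> 'b set"
    and Pos Neg :: "('h \<times> (nat \<Rightarrow> 'b)) set"
  assumes H: "countable H"
    and normal: "\<And>\<psi>. \<psi> \<in> H \<Longrightarrow> MOST n. \<forall>c\<in>A n. \<forall>d\<in>A n. \<forall>\<beta>\<in>B n. \<forall>\<gamma>\<in>B n.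
      Q \<psi> n \<beta> c \<longrightarrow> Q \<psi> n \<gamma> c \<longrightarrow> Q \<psi> n \<beta> d \<longrightarrow> Q \<psi> n \<gamma> d"
    and Pos: "Pos \<subseteq> H \<times> (\<Pi> n\<in>UNIV. B n)" and Neg: "Neg \<subseteq> H \<times> (\<Pi> n\<in>UNIV. B n)"
    and card: "|Neg| <o continuum"
    and fin_pos: "\<And>P. finite P \<Longrightarrow> P \<subseteq> Pos \<Longrightarrow>
      \<exists>x\<in>(\<Pi> n\<in>UNIV. A n). \<forall>(\<psi>, b)\<in>P. MOST n. Q \<psi> n (b n) (x n)"
    and fin_neg: "\<And>P \<psi> b. finite P \<Longrightarrow> P \<subseteq> Pos \<Longrightarrow> (\<psi>, b) \<in> Neg \<Longrightarrow>
      \<exists>x\<in>(\<Pi> n\<in>UNIV. A n). (\<forall>(\<psi>, b)\<in>P. MOST n. Q \<psi> n (b n) (x n)) \<and>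
        (INFM n. \<not> Q \<psi> n (b n) (x n))"
  shows "\<exists>x\<in>(\<Pi> n\<in>UNIV. A n). (\<forall>(\<psi>, b)\<in>Pos. MOST n. Q \<psi> n (b n) (x n)) \<and>
    (\<forall>(\<psi>, b)\<in>Neg. INFM n. \<not> Q \<psi> n (b n) (x n))"
proof -
  define H1 where "H1 = {\<psi>\<in>H. \<exists>b. (\<psi>, b) \<in> Pos}"
  \<comment> \<open>One positive instance per formula suffices: two positive instances of
    \<open>\<psi>\<close> have a common realisation, so by normality they define the same set on
    almost all coordinates. Countably many conditions remain.\<close>
  define sel where "sel \<psi> = (SOME b. (\<psi>, b) \<in> Pos)" for \<psi>
  have sel: "(\<psi>, sel \<psi>) \<in> Pos" if "\<psi> \<in> H1" for \<psi>
    unfolding sel_def by (rule someI_ex[where P = "\<lambda>b. (\<psi>, b) \<in> Pos"]) (use that in \<open>auto simp: H1_def\<close>)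
  define Hk where "Hk k = {\<psi>\<in>H1. to_nat_on H \<psi> \<le> k}" for k
  have fin_Hk: "finite (Hk k)" for k
  proof -
    have "inj_on (to_nat_on H) (Hk k)"
      using inj_on_to_nat_on[OF H] by (rule inj_on_subset) (auto simp: Hk_def H1_def)
    moreover have "finite (to_nat_on H ` Hk k)"
      by (rule finite_subset[of _ "{..k}"]) (auto simp: Hk_def)
    ultimately show ?thesis by (simp add: finite_image_iff)
  qed
  \<comment> \<open>\<open>D k n\<close> solves the first finitely many of these conditions at
    coordinate \<open>n\<close>. A sequence that lies, for each \<open>k\<close>, in
    \<open>D k n\<close> at almost all \<open>n\<close> realises the whole positive part, as
    \<open>pos\<close> shows.\<close>
  define D where "D k n = {c\<in>A n. \<forall>\<psi>\<in>Hk k. Q \<psi> n (sel \<psi> n) c}" for k n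
  have D_mono: "D l n \<subseteq> D k n" if "k \<le> l" for k l n
    using that by (auto simp: D_def Hk_def)
  have D_A: "D k n \<subseteq> A n" for k n by (auto simp: D_def)
  let ?P = "\<lambda>k. (\<lambda>\<psi>. (\<psi>, sel \<psi>)) ` Hk k"
  have P: "finite (?P k)" "?P k \<subseteq> Pos" for k
    using fin_Hk sel by (auto simp: Hk_def)
  have in_D: "MOST n. x n \<in> D k n"
    if "x \<in> (\<Pi> n\<in>UNIV. A n)" "\<forall>(\<psi>, b)\<in>?P k. MOST n. Q \<psi> n (b n) (x n)" for x k
  proof -
    have "MOST n. \<forall>\<psi>\<in>Hk k. Q \<psi> n (sel \<psi> n) (x n)"
      using that(2) by (simp add: MOST_finite_Ball_distrib fin_Hk)
    then show ?thesis by (rule MOST_mono) (use that(1) in \<open>auto simp: D_def\<close>)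
  qed
  have D_ne: "MOST n. D k n \<noteq> {}" for k
  proof -
    obtain x where "x \<in> (\<Pi> n\<in>UNIV. A n)" "\<forall>(\<psi>, b)\<in>?P k. MOST n. Q \<psi> n (b n) (x n)"
      using fin_pos[OF P] by blast
    then show ?thesis by (intro MOST_mono[OF in_D]) auto
  qed

  \<comment> \<open>A base realisation of the positive part\<close>
  obtain x0 where x0: "x0 \<in> (\<Pi> n\<in>UNIV. A n)" using fin_pos[of "{}"] by auto
  define K where "K n = {k. k \<le> n \<and> D k n \<noteq> {}}" for n
  define z where "z n = (if K n = {} then x0 n else (SOME c. c \<in> D (Max (K n)) n))" for n
  have z_D: "z n \<in> D (Max (K n)) n" if "K n \<noteq> {}" for n
  proof -
    have "Max (K n) \<in> K n" using that by (intro Max_in) (auto simp: K_def)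
    then have "\<exists>c. c \<in> D (Max (K n)) n" by (auto simp: K_def)
    then show ?thesis using that someI_ex[of "\<lambda>c. c \<in> D (Max (K n)) n"] by (simp add: z_def)
  qed
  have z_A: "z n \<in> A n" for n
    using z_D[of n] D_A x0 by (cases "K n = {}") (auto simp: z_def)
  have z: "MOST n. z n \<in> D k n" for k
    using MOST_conjI[OF D_ne[of k] MOST_ge_nat[of k]]
  proof (rule MOST_mono)
    fix n assume "D k n \<noteq> {} \<and> k \<le> n"
    then have "k \<in> K n" by (simp add: K_def)
    moreover from this have "k \<le> Max (K n)" by (intro Max_ge) (auto simp: K_def)
    ultimately show "z n \<in> D k n" using z_D D_mono by blast
  qed

  \<comment> \<open>A family of realisations indexed by binary sequences\<close>
  define apart where "apart \<psi> n c d \<longleftrightarrow> (\<forall>\<beta>\<in>B n. \<not> (Q \<psi> n \<beta> c \<and> Q \<psi> n \<beta> d))" for \<psi> n c d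
  \<comment> \<open>These formulas are left undecided by the positive part: however deep the stage,
    infinitely many coordinates carry two points of \<open>D k n\<close> that share no instance of
    \<open>\<psi>\<close>.\<close>
  define NT where "NT = {\<psi>\<in>H. \<forall>k. INFM n. \<exists>c\<in>D k n. \<exists>d\<in>D k n. apart \<psi> n c d}"
  \<comment> \<open>A label \<open>(\<psi>, m)\<close> marks coordinates at which bit
    \<open>m\<close> of a binary sequence chooses between two points that are apart for
    \<open>\<psi>\<close>. Every pair of a formula and a bit receives infinitely many
    coordinates.\<close>
  have NT: "countable (NT \<times> (UNIV :: nat set))"
    using H by (auto simp: NT_def intro: countable_subset)
  have NT_inf: "INFM n. \<exists>c\<in>D s n. \<exists>d\<in>D s n. apart (fst k) n c d"
    if "k \<in> NT \<times> (UNIV :: nat set)" for k s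
    using that by (auto simp: NT_def)
  obtain lab :: "nat \<Rightarrow> ('h \<times> nat) option" and st where
      lab: "\<And>n k. lab n = Some k \<Longrightarrow> k \<in> NT \<times> UNIV \<and>
        (\<exists>c\<in>D (st n) n. \<exists>d\<in>D (st n) n. apart (fst k) n c d)"
      and st: "\<And>s. MOST n. lab n \<noteq> None \<longrightarrow> s \<le> st n"
      and lab_inf: "\<And>k. k \<in> NT \<times> UNIV \<Longrightarrow> INFM n. lab n = Some k"
    by (rule staged_disjoint_selection[OF NT,
          where P = "\<lambda>k s n. \<exists>c\<in>D s n. \<exists>d\<in>D s n. apart (fst k) n c d"])
      (erule NT_inf, blast)
  have "\<forall>n. \<exists>c d. \<forall>k. lab n = Some k \<longrightarrow> c \<in> D (st n) n \<and> d \<in> D (st n) n \<and> apart (fst k) n c d"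
  proof
    fix n
    show "\<exists>c d. \<forall>k. lab n = Some k \<longrightarrow> c \<in> D (st n) n \<and> d \<in> D (st n) n \<and> apart (fst k) n c d"
      using lab[of n] by (cases "lab n") auto
  qed
  then obtain c d where cd: "\<And>n k. lab n = Some k \<Longrightarrow>
      c n \<in> D (st n) n \<and> d n \<in> D (st n) n \<and> apart (fst k) n (c n) (d n)"
    unfolding choice_iff by blast
  define x where "x f n = (case lab n of None \<Rightarrow> z n | Some k \<Rightarrow> if f (snd k) then c n else d n)"
    for f :: "nat \<Rightarrow> bool" and n
  have "x f n \<in> A n" for f n
    using z_A[of n] cd[of n] D_A[of "st n" n] by (cases "lab n") (auto simp: x_def)
  then have x_A: "x f \<in> (\<Pi> n\<in>UNIV. A n)" for f by auto
  \<comment> \<open>Unlabelled coordinates carry \<open>z\<close>, and \<open>st\<close> tends to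
    infinity along the others, so each member of the family passes through every stage.\<close>
  have x_D: "MOST n. x f n \<in> D k n" for f k
    using MOST_conjI[OF z[of k] st[of k]]
  proof (rule MOST_mono)
    fix n assume "z n \<in> D k n \<and> (lab n \<noteq> None \<longrightarrow> k \<le> st n)"
    then show "x f n \<in> D k n"
      using cd[of n] D_mono[of k "st n" n] by (cases "lab n") (auto simp: x_def)
  qed

  \<comment> \<open>Positive instances, and negated instances of formulas outside
    \<open>NT\<close>\<close>
  have pos: "MOST n. Q \<psi> n (b n) (y n)"
    if b: "(\<psi>, b) \<in> Pos" and y: "y \<in> (\<Pi> n\<in>UNIV. A n)" "\<And>k. MOST n. y n \<in> D k n" for \<psi> b y
  proof -
    have \<psi>: "\<psi> \<in> H1" "\<psi> \<in> H" using that Pos by (auto simp: H1_def)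
    obtain w where w: "w \<in> (\<Pi> n\<in>UNIV. A n)" "MOST n. Q \<psi> n (b n) (w n)"
        "MOST n. Q \<psi> n (sel \<psi> n) (w n)"
      using fin_pos[of "{(\<psi>, b), (\<psi>, sel \<psi>)}"] b sel[OF \<psi>(1)] by auto
    have "b \<in> (\<Pi> n\<in>UNIV. B n)" "sel \<psi> \<in> (\<Pi> n\<in>UNIV. B n)"
      using that(1) sel[OF \<psi>(1)] Pos by auto
    then have B: "b n \<in> B n" "sel \<psi> n \<in> B n" for n by auto
    show ?thesis
      using normal[OF \<psi>(2)] w(2,3) y(2)[of "to_nat_on H \<psi>"]
    proof eventually_elim
      case (elim n)
      have "Q \<psi> n (sel \<psi> n) (y n)" using elim(4) \<psi> by (auto simp: D_def Hk_def)
      moreover have "w n \<in> A n" "y n \<in> A n" using w(1) y(1) by auto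
      ultimately show ?case using elim(1-3) B[of n] by blast
    qed
  qed
  have neg_trivial: "INFM n. \<not> Q \<psi> n (b n) (y n)"
    if b_Neg: "(\<psi>, b) \<in> Neg" and "\<psi> \<notin> NT" and y: "y \<in> (\<Pi> n\<in>UNIV. A n)" "\<And>k. MOST n. y n \<in> D k n" for \<psi> b y
  proof (rule ccontr)
    assume "\<not> ?thesis"
    then have Qy: "MOST n. Q \<psi> n (b n) (y n)" by simp
    have \<psi>: "\<psi> \<in> H" and b: "b \<in> (\<Pi> n\<in>UNIV. B n)" using that Neg by auto
    obtain k where k: "MOST n. \<forall>c\<in>D k n. \<forall>d\<in>D k n. \<not> apart \<psi> n c d"
      using \<open>\<psi> \<notin> NT\<close> \<psi> by (auto simp: NT_def)
    obtain w where w: "w \<in> (\<Pi> n\<in>UNIV. A n)" "\<forall>(\<psi>, b)\<in>?P k. MOST n. Q \<psi> n (b n) (w n)"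
        "INFM n. \<not> Q \<psi> n (b n) (w n)"
      using fin_neg[OF P b_Neg] by blast
    \<comment> \<open>At almost all \<open>n\<close>, any two points of \<open>D k n\<close> share
      an instance of \<open>\<psi>\<close>, hence by normality satisfy the same instances. So
      \<open>w\<close>, which avoids \<open>b\<close> infinitely often, would satisfy it along with
      \<open>y\<close>.\<close>
    have "MOST n. Q \<psi> n (b n) (w n)"
      using normal[OF \<psi>] k in_D[OF w(1,2)] y(2)[of k] Qy
    proof eventually_elim
      case (elim n)
      from elim(2-4) have "\<not> apart \<psi> n (y n) (w n)" by blast
      then obtain \<beta> where "\<beta> \<in> B n" "Q \<psi> n \<beta> (y n)" "Q \<psi> n \<beta> (w n)"
        by (auto simp: apart_def)
      moreover have "w n \<in> A n" "y n \<in> A n" "b n \<in> B n" using w(1) y(1) b by auto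
      ultimately show ?case using elim(1,5) by blast
    qed
    then show False using w(3) by (simp add: frequently_def)
  qed

  \<comment> \<open>A negated instance of a formula in \<open>NT\<close> excludes at most one binary
    sequence: if \<open>f\<close> and \<open>g\<close> differ in bit \<open>m\<close>, then at the
    infinitely many coordinates labelled \<open>(\<psi>, m)\<close> their values are apart.\<close>
  have neg_unique: "f = g"
    if "(\<psi>, b) \<in> Neg" "\<psi> \<in> NT" "MOST n. Q \<psi> n (b n) (x f n)" "MOST n. Q \<psi> n (b n) (x g n)"
    for \<psi> b f g
  proof (rule ccontr)
    assume "f \<noteq> g"
    then obtain m where m: "f m \<noteq> g m" by auto
    have b: "b \<in> (\<Pi> n\<in>UNIV. B n)" using that Neg by auto
    have "INFM n. lab n = Some (\<psi>, m) \<and> Q \<psi> n (b n) (x f n) \<and> Q \<psi> n (b n) (x g n)"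
      using INFM_conjI[OF lab_inf[of "(\<psi>, m)"] MOST_conjI[OF that(3,4)]] that(2) by simp
    then obtain n where n: "lab n = Some (\<psi>, m)" "Q \<psi> n (b n) (x f n)" "Q \<psi> n (b n) (x g n)"
      by (auto dest: INFM_EX)
    have "apart \<psi> n (c n) (d n)" using cd[OF n(1)] by simp
    moreover have "b n \<in> B n" using b by auto
    moreover have "Q \<psi> n (b n) (c n) \<and> Q \<psi> n (b n) (d n)"
      using n m by (cases "f m") (simp_all add: x_def)
    ultimately show False unfolding apart_def by blast
  qed
  \<comment> \<open>Choosing for each excluded \<open>f\<close> an instance that excludes it is
    injective, so fewer than continuum many binary sequences are excluded.\<close>
  define Bad where "Bad = {f. \<exists>\<nu>\<in>Neg. fst \<nu> \<in> NT \<and> (MOST n. Q (fst \<nu>) n (snd \<nu> n) (x f n))}"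
  have "\<exists>w. \<forall>f\<in>Bad. w f \<in> Neg \<and> fst (w f) \<in> NT \<and> (MOST n. Q (fst (w f)) n (snd (w f) n) (x f n))"
    unfolding Bad_def by (rule bchoice) blast
  then obtain w where w: "\<And>f. f \<in> Bad \<Longrightarrow>
      w f \<in> Neg \<and> fst (w f) \<in> NT \<and> (MOST n. Q (fst (w f)) n (snd (w f) n) (x f n))"
    by blast
  have "inj_on w Bad"
  proof (rule inj_onI)
    fix f g assume "f \<in> Bad" "g \<in> Bad" "w f = w g"
    then show "f = g" using w[of f] w[of g] neg_unique[of "fst (w f)" "snd (w f)" f g] by auto
  qed
  then have "|Bad| \<le>o |Neg|" using w by (intro card_of_ordLeqI) auto
  then have "|Bad| <o |UNIV :: (nat \<Rightarrow> bool) set|"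
    by (rule ordLeq_ordLess_trans[OF _ ordLess_ordIso_trans[OF card continuum_ordIso]])
  then have "Bad \<noteq> UNIV" using ordLess_irreflexive by metis
  then obtain f where "f \<notin> Bad" by (metis UNIV_eq_I)
  have "INFM n. \<not> Q \<psi> n (b n) (x f n)" if "(\<psi>, b) \<in> Neg" for \<psi> b
  proof (cases "\<psi> \<in> NT")
    case True
    have "f \<in> Bad" if "MOST n. Q \<psi> n (b n) (x f n)"
      unfolding Bad_def using True that \<open>(\<psi>, b) \<in> Neg\<close>
      by (intro CollectI bexI[of _ "(\<psi>, b)"]) simp_all
    then have "\<not> (MOST n. Q \<psi> n (b n) (x f n))" using \<open>f \<notin> Bad\<close> by metis
    then show ?thesis by simp
  next
    case False
    then show ?thesis by (rule neg_trivial[OF that _ x_A x_D])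
  qed
  then show ?thesis using x_A pos[OF _ x_A x_D] by (intro bexI[of _ "x f"]) auto
qed

section \<open>Parameter-free formulas\<close>

instance tm :: (countable, countable) countable
  by countable_datatype

instance fm :: (countable, countable, countable) countable
  by countable_datatype

lemma tm_params_eq_set: "tm_params t = set2_tm t"
  by (induction t) auto

lemma fm_params_eq_set: "fm_params \<phi> = set3_fm \<phi>"
  by (induction \<phi>) (auto simp: tm_params_eq_set)

lemma tm_wf_set: "tm_wf L t \<Longrightarrow> set1_tm t \<subseteq> funs L"
  by (induction t) (auto simp: list_all_iff)

lemma fm_wf_set: "fm_wf L \<phi> \<Longrightarrow> set1_fm \<phi> \<subseteq> funs L \<and> set2_fm \<phi> \<subseteq> rels L"
proof (induction \<phi>)
  case (Eq s t)
  then show ?case using tm_wf_set[of L s] tm_wf_set[of L t] by auto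
next
  case (Rel r ts)
  then show ?case using tm_wf_set[of L] by (fastforce simp: list_all_iff)
qed auto

text \<open>The element type may be uncountable. Numbering the symbols and collapsing all parameters
  to one value is injective on formulas without parameters and lands in a countable type.\<close>

lemma countable_parameter_free_formulas:
  assumes "countable_language L"
  shows "countable {\<phi> :: ('f, 'r, 'a) fm. fm_wf L \<phi> \<and> fm_params \<phi> = {}}" (is "countable ?S")
proof -
  have L: "countable (funs L)" "countable (rels L)"
    using assms by (auto simp: countable_language_def)
  let ?m = "map_fm (to_nat_on (funs L)) (to_nat_on (rels L)) (\<lambda>_. ())"
  have "inj_on ?m ?S"
  proof (rule inj_onI)
    fix \<phi> \<psi> assume \<phi>: "\<phi> \<in> ?S" and \<psi>: "\<psi> \<in> ?S" and eq: "?m \<phi> = ?m \<psi>"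
    show "\<phi> = \<psi>"
    proof (rule fm.inj_map_strong[OF _ _ _ eq])
      show "z = z'" if "z \<in> set1_fm \<phi>" "z' \<in> set1_fm \<psi>"
        "to_nat_on (funs L) z = to_nat_on (funs L) z'" for z z'
        using that L \<phi> \<psi> fm_wf_set[of L \<phi>] fm_wf_set[of L \<psi>] by (auto simp: subset_iff)
      show "z = z'" if "z \<in> set2_fm \<phi>" "z' \<in> set2_fm \<psi>"
        "to_nat_on (rels L) z = to_nat_on (rels L) z'" for z z'
        using that L \<phi> \<psi> fm_wf_set[of L \<phi>] fm_wf_set[of L \<psi>] by (auto simp: subset_iff)
      show "z = z'" if "z \<in> set3_fm \<phi>" for z z'
        using that \<phi> by (auto simp: fm_params_eq_set)
    qed
  qed
  then show ?thesis by (rule countableI')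
qed

lemma finite_tm_vars: "finite (tm_vars t)"
  by (induction t) auto

lemma finite_fm_vars: "finite (fm_vars \<phi>)"
  by (induction \<phi>) (auto simp: finite_tm_vars)

lemma finite_tm_params: "finite (tm_params t)"
  by (induction t) auto

lemma finite_fm_params: "finite (fm_params \<phi>)"
  by (induction \<phi>) (auto simp: finite_tm_params)

section \<open>Turning parameters into variables\<close>

primrec tm_abstract :: "('a \<Rightarrow> nat) \<Rightarrow> ('f, 'a) tm \<Rightarrow> ('f, 'a) tm" where
  "tm_abstract g (Var n) = Var n"
| "tm_abstract g (Par a) = Var (g a)"
| "tm_abstract g (Fn f ts) = Fn f (map (tm_abstract g) ts)"

primrec fm_abstract :: "('a \<Rightarrow> nat) \<Rightarrow> ('f, 'r, 'a) fm \<Rightarrow> ('f, 'r, 'a) fm" where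
  "fm_abstract g (Eq s t) = Eq (tm_abstract g s) (tm_abstract g t)"
| "fm_abstract g (Rel r ts) = Rel r (map (tm_abstract g) ts)"
| "fm_abstract g (Neg \<phi>) = Neg (fm_abstract g \<phi>)"
| "fm_abstract g (And \<phi> \<psi>) = And (fm_abstract g \<phi>) (fm_abstract g \<psi>)"
| "fm_abstract g (Ex n \<phi>) = Ex n (fm_abstract g \<phi>)"

text \<open>A variable outside this set can replace a parameter anywhere in the formula without
  being captured.\<close>

primrec fm_bound :: "('f, 'r, 'a) fm \<Rightarrow> nat set" where
  "fm_bound (Eq s t) = {}"
| "fm_bound (Rel r ts) = {}"
| "fm_bound (Neg \<phi>) = fm_bound \<phi>"
| "fm_bound (And \<phi> \<psi>) = fm_bound \<phi> \<union> fm_bound \<psi>"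
| "fm_bound (Ex n \<phi>) = insert n (fm_bound \<phi>)"

lemma finite_fm_bound: "finite (fm_bound \<phi>)"
  by (induction \<phi>) auto

lemma tm_abstract_wf: "tm_wf L t \<Longrightarrow> tm_wf L (tm_abstract g t) \<and> tm_params (tm_abstract g t) = {}"
  by (induction t) (auto simp: list_all_iff)

lemma fm_abstract_wf: "fm_wf L \<phi> \<Longrightarrow> fm_wf L (fm_abstract g \<phi>) \<and> fm_params (fm_abstract g \<phi>) = {}"
  by (induction \<phi>) (auto simp: list_all_iff tm_abstract_wf)

lemma tm_val_abstract:
  "(\<And>a. a \<in> tm_params t \<Longrightarrow> e (g a) = a) \<Longrightarrow> tm_val M e (tm_abstract g t) = tm_val M e t"
proof (induction t)
  case (Fn f ts)
  have "tm_val M e (tm_abstract g t) = tm_val M e t" if "t \<in> set ts" for t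
    by (rule Fn.IH[OF that]) (use Fn.prems that in auto)
  then have "map (tm_val M e \<circ> tm_abstract g) ts = map (tm_val M e) ts" by simp
  then show ?case by (simp del: map_eq_conv)
qed auto

lemma sat_abstract:
  "(\<And>a. a \<in> fm_params \<phi> \<Longrightarrow> e (g a) = a \<and> g a \<notin> fm_bound \<phi>) \<Longrightarrow>
    sat M e (fm_abstract g \<phi>) \<longleftrightarrow> sat M e \<phi>"
proof (induction \<phi> arbitrary: e)
  case (Eq s t)
  then show ?case by (simp add: tm_val_abstract)
next
  case (Rel r ts)
  then have "map (tm_val M e \<circ> tm_abstract g) ts = map (tm_val M e) ts"
    by (auto intro!: tm_val_abstract)
  then show ?case by (simp del: map_eq_conv)
next
  case (Neg \<phi>)
  then show ?case by (metis fm_abstract.simps(3) fm_bound.simps(3) fm_params.simps(3) sat.simps(3))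
next
  case (And \<phi> \<psi>)
  have "sat M e (fm_abstract g \<phi>) = sat M e \<phi>" by (rule And.IH) (use And.prems in auto)
  moreover have "sat M e (fm_abstract g \<psi>) = sat M e \<psi>" by (rule And.IH) (use And.prems in auto)
  ultimately show ?case by simp
next
  case (Ex n \<phi>)
  have "sat M (e(n := b)) (fm_abstract g \<phi>) = sat M (e(n := b)) \<phi>" for b
    by (rule Ex.IH) (use Ex.prems in auto)
  then show ?case by simp
qed

text \<open>Assignments are coded by finite lists with a default value, so that there are no more of
  them than lists of parameters.\<close>

definition list_env :: "'a \<Rightarrow> 'a list \<Rightarrow> nat \<Rightarrow> 'a" where
  "list_env d l i = (if i < length l then l ! i else d)"

text \<open>Each parameter becomes a variable that is neither \<open>0\<close> nor bound, and
  \<open>l\<close> supplies its value. Instances over \<open>X\<close> thus come from formulas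
  without parameters, of which there are countably many for a countable language.\<close>

lemma parameters_as_variables:
  fixes \<phi> :: "('f, 'r, 'a) fm"
  assumes wf: "fm_wf L \<phi>" and X: "fm_params \<phi> \<subseteq> X" "d \<in> X" and vars: "fm_vars \<phi> \<subseteq> {0}"
  obtains \<phi>' :: "('f, 'r, 'a) fm" and l where "fm_wf L \<phi>'" "fm_params \<phi>' = {}" "l \<in> lists X"
    "\<And>M a. sat M (\<lambda>_. a) \<phi> \<longleftrightarrow> sat M ((list_env d l)(0 := a)) \<phi>'"
proof -
  obtain ps where ps: "set ps = fm_params \<phi>" using finite_list[OF finite_fm_params[of \<phi>]] ..
  obtain N where N: "fm_bound \<phi> \<subseteq> {..<N}"
    using finite_nat_bounded[OF finite_fm_bound[of \<phi>]] ..
  have "\<forall>a\<in>fm_params \<phi>. \<exists>i<length ps. ps ! i = a" unfolding ps[symmetric] by (simp add: in_set_conv_nth)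
  from bchoice[OF this] obtain ix where
    ix: "\<forall>a\<in>fm_params \<phi>. ix a < length ps \<and> ps ! ix a = a" ..
  \<comment> \<open>The shift by \<open>Suc N\<close> clears \<open>0\<close>, the variable of the
    type, and the bound variables, which are below \<open>N\<close>; the padding by \<open>d\<close>
    in \<open>l\<close> fills these positions.\<close>
  define g where "g a = Suc N + ix a" for a
  define l where "l = replicate (Suc N) d @ ps"
  have l: "l \<in> lists X" using X ps by (auto simp: l_def)
  have "sat M (\<lambda>_. a) \<phi> \<longleftrightarrow> sat M ((list_env d l)(0 := a)) (fm_abstract g \<phi>)" for M a
  proof -
    have "sat M ((list_env d l)(0 := a)) (fm_abstract g \<phi>) \<longleftrightarrow> sat M ((list_env d l)(0 := a)) \<phi>"
    proof (rule sat_abstract)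
      fix b assume "b \<in> fm_params \<phi>"
      then have b: "ix b < length ps" "ps ! ix b = b" using ix by auto
      have "list_env d l (g b) = b"
        using b by (simp add: list_env_def l_def g_def nth_append)
      moreover have "g b \<noteq> 0" by (simp add: g_def)
      moreover have "g b \<notin> fm_bound \<phi>"
      proof
        assume "g b \<in> fm_bound \<phi>"
        then have "g b < N" using N by blast
        then show False by (simp add: g_def)
      qed
      ultimately show "((list_env d l)(0 := a)) (g b) = b \<and> g b \<notin> fm_bound \<phi>" by simp
    qed
    also have "\<dots> \<longleftrightarrow> sat M (\<lambda>_. a) \<phi>" by (rule sat_cong) (use vars in auto)
    finally show ?thesis by simp
  qed
  then show ?thesis
    by (rule that[OF conjunct1[OF fm_abstract_wf[OF wf]] conjunct2[OF fm_abstract_wf[OF wf]] l])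
qed

section \<open>h-formulas in reduced products\<close>

text \<open>Without the first conjunct the universal part could hold vacuously in the product,
  because \<open>\<phi>\<close> has no solution at infinitely many coordinates, and yet fail at
  infinitely many others.\<close>

abbreviation himp :: "nat \<Rightarrow> ('f, 'r, 'a) fm \<Rightarrow> ('f, 'r, 'a) fm \<Rightarrow> ('f, 'r, 'a) fm" where
  "himp m \<phi> \<psi> \<equiv> And (Ex m \<phi>) (Neg (Ex m (And \<phi> (Neg \<psi>))))"

inductive h_formula :: "('f, 'r) language \<Rightarrow> ('f, 'r, 'a) fm \<Rightarrow> bool" for L where
  h_Eq: "tm_wf L s \<Longrightarrow> tm_wf L t \<Longrightarrow> tm_params s = {} \<Longrightarrow> tm_params t = {} \<Longrightarrow> h_formula L (Eq s t)"
| h_Rel: "r \<in> rels L \<Longrightarrow> length ts = rel_arity L r \<Longrightarrow>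
    \<forall>t\<in>set ts. tm_wf L t \<and> tm_params t = {} \<Longrightarrow> h_formula L (Rel r ts)"
| h_And: "h_formula L \<phi> \<Longrightarrow> h_formula L \<psi> \<Longrightarrow> h_formula L (And \<phi> \<psi>)"
| h_Ex: "h_formula L \<phi> \<Longrightarrow> h_formula L (Ex m \<phi>)"
| h_himp: "h_formula L \<phi> \<Longrightarrow> h_formula L \<psi> \<Longrightarrow> h_formula L (himp m \<phi> \<psi>)"

lemma h_formula_wf: "h_formula L \<phi> \<Longrightarrow> fm_wf L \<phi> \<and> fm_params \<phi> = {}"
  by (induction rule: h_formula.induct) (auto simp: list_all_iff)

lemma h_formula_conjunction:
  assumes "finite P" "\<And>\<chi>. \<chi> \<in> P \<Longrightarrow> h_formula L \<chi>"
  shows "\<exists>\<phi>. h_formula L \<phi> \<and> (\<forall>M e. sat M e \<phi> \<longleftrightarrow> (\<forall>\<chi>\<in>P. sat M e \<chi>))"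
  using assms
proof (induction P rule: finite_induct)
  case empty
  then show ?case by (intro exI[of _ "Eq (Var 0) (Var 0)"]) (auto intro: h_Eq)
next
  case (insert \<chi> P)
  then obtain \<phi> where "h_formula L \<phi>" "\<forall>M e. sat M e \<phi> \<longleftrightarrow> (\<forall>\<chi>\<in>P. sat M e \<chi>)" by auto
  then show ?case using insert.prems by (intro exI[of _ "And \<chi> \<phi>"]) (auto intro: h_And)
qed

locale fin_reduced_product =
  fixes L :: "('f, 'r) language" and M :: "nat \<Rightarrow> ('f, 'r, 'a) struct"
  assumes struct: "\<And>n. is_struct L (M n)"
begin

abbreviation R :: "('f, 'r, (nat \<Rightarrow> 'a) set) struct" where
  "R \<equiv> reduced_product Fin M"

definition cls :: "(nat \<Rightarrow> 'a) \<Rightarrow> (nat \<Rightarrow> 'a) set" where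
  "cls a = eq_mod Fin M `` {a}"

text \<open>Formulas over \<open>R\<close> without parameters are retyped as formulas over \<open>M n\<close>.\<close>

definition loc_val :: "nat \<Rightarrow> (nat \<Rightarrow> 'a) \<Rightarrow> ('f, (nat \<Rightarrow> 'a) set) tm \<Rightarrow> 'a" where
  "loc_val n \<epsilon> t = tm_val (M n) \<epsilon> (map_tm id (\<lambda>_. undefined) t)"

definition loc_sat :: "nat \<Rightarrow> (nat \<Rightarrow> 'a) \<Rightarrow> ('f, 'r, (nat \<Rightarrow> 'a) set) fm \<Rightarrow> bool" where
  "loc_sat n \<epsilon> \<phi> \<longleftrightarrow> sat (M n) \<epsilon> (map_fm id id (\<lambda>_. undefined) \<phi>)"

lemma loc_val_simps [simp]:
  "loc_val n \<epsilon> (Var v) = \<epsilon> v"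
  "loc_val n \<epsilon> (Fn f ts) = fun_in (M n) f (map (loc_val n \<epsilon>) ts)"
  by (simp_all add: loc_val_def[abs_def] comp_def)

lemma loc_sat_simps [simp]:
  "loc_sat n \<epsilon> (Eq s t) \<longleftrightarrow> loc_val n \<epsilon> s = loc_val n \<epsilon> t"
  "loc_sat n \<epsilon> (Rel r ts) \<longleftrightarrow> rel_in (M n) r (map (loc_val n \<epsilon>) ts)"
  "loc_sat n \<epsilon> (Neg \<phi>) \<longleftrightarrow> \<not> loc_sat n \<epsilon> \<phi>"
  "loc_sat n \<epsilon> (And \<phi> \<psi>) \<longleftrightarrow> loc_sat n \<epsilon> \<phi> \<and> loc_sat n \<epsilon> \<psi>"
  "loc_sat n \<epsilon> (Ex m \<phi>) \<longleftrightarrow> (\<exists>c\<in>univ (M n). loc_sat n (\<epsilon>(m := c)) \<phi>)"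
  by (simp_all add: loc_sat_def loc_val_def[abs_def] comp_def)

lemma univ_R: "univ R = cls ` prod_univ M"
  by (auto simp: reduced_product_def quotient_def cls_def)

lemma cls_eq_iff:
  assumes "a \<in> prod_univ M" "b \<in> prod_univ M"
  shows "cls a = cls b \<longleftrightarrow> (MOST n. a n = b n)"
proof -
  have "cls a = cls b \<longleftrightarrow> (a, b) \<in> eq_mod Fin M"
    unfolding cls_def by (rule eq_equiv_class_iff[OF equiv_eq_mod[OF is_ideal_Fin] assms])
  then show ?thesis using assms by (simp add: eq_mod_def Fin_def MOST_iff_cofinite)
qed

lemma rep_in_prod_univ_and_cls_rep:
  assumes "c \<in> univ R"
  shows "rep c \<in> prod_univ M \<and> cls (rep c) = c"
proof -
  obtain a where a: "a \<in> prod_univ M" "c = cls a" using assms unfolding univ_R by blast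
  then have "(a, rep c) \<in> eq_mod Fin M" using rep_in_class[OF is_ideal_Fin a(1)] by (simp add: cls_def)
  then have "cls a = cls (rep c)"
    unfolding cls_def by (rule equiv_class_eq[OF equiv_eq_mod[OF is_ideal_Fin]])
  moreover have "rep c \<in> prod_univ M"
    using \<open>(a, rep c) \<in> eq_mod Fin M\<close> by (simp add: eq_mod_def)
  ultimately show ?thesis using a(2) by (simp only: simp_thms)
qed

lemma lift_env:
  assumes "range e \<subseteq> univ R"
  obtains u where "\<And>v. u v \<in> prod_univ M" "e = (\<lambda>v. cls (u v))"
proof (rule that[of "\<lambda>v. rep (e v)"])
  have "rep (e v) \<in> prod_univ M \<and> cls (rep (e v)) = e v" for v
    using rep_in_prod_univ_and_cls_rep[OF range_subsetD[OF assms]] .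
  then show "rep (e v) \<in> prod_univ M" "e = (\<lambda>v. cls (rep (e v)))" for v
    by (simp_all only: fun_eq_iff simp_thms)
qed

lemma prod_univ_nonempty: "prod_univ M \<noteq> {}"
proof -
  have "(SOME c. c \<in> univ (M n)) \<in> univ (M n)" for n
    using struct[of n] by (simp add: is_struct_def some_in_eq)
  then have "(\<lambda>n. SOME c. c \<in> univ (M n)) \<in> prod_univ M" by (simp add: prod_univ_def)
  then show ?thesis by blast
qed

lemma is_struct_R: "is_struct L R"
  unfolding is_struct_def
proof (intro conjI ballI allI impI)
  show "univ R \<noteq> {}" using prod_univ_nonempty by (simp add: univ_R)
next
  fix f cs assume f: "f \<in> funs L" and cs: "set cs \<subseteq> univ R \<and> length cs = fun_arity L f"
  have "(\<lambda>n. fun_in (M n) f (map (\<lambda>c. rep c n) cs)) \<in> prod_univ M"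
    unfolding prod_univ_def
  proof
    fix n
    have "set (map (\<lambda>c. rep c n) cs) \<subseteq> univ (M n)"
      using cs rep_in_prod_univ_and_cls_rep by (fastforce simp: prod_univ_def)
    then show "fun_in (M n) f (map (\<lambda>c. rep c n) cs) \<in> univ (M n)"
      using struct[of n] f cs by (simp add: is_struct_def)
  qed
  then show "fun_in R f cs \<in> univ R"
    by (simp add: reduced_product_def quotientI)
qed

lemma is_model_R: "is_model L (Th L R) R"
  using is_struct_R by (auto simp: is_model_def Th_def)

lemma tm_val_R:
  assumes u: "\<And>v. u v \<in> prod_univ M" and "tm_wf L t" "tm_params t = {}"
  shows "(\<lambda>n. loc_val n (\<lambda>v. u v n) t) \<in> prod_univ M \<and>
    tm_val R (\<lambda>v. cls (u v)) t = cls (\<lambda>n. loc_val n (\<lambda>v. u v n) t)"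
  using assms(2,3)
proof (induction t)
  case (Var v)
  then show ?case using u by simp
next
  case (Par a)
  then show ?case by simp
next
  case (Fn f ts)
  let ?a = "\<lambda>t n. loc_val n (\<lambda>v. u v n) t"
  have IH: "?a t \<in> prod_univ M \<and> tm_val R (\<lambda>v. cls (u v)) t = cls (?a t)" if "t \<in> set ts" for t
    by (rule Fn.IH[OF that]) (use Fn.prems that in \<open>simp_all add: list_all_iff\<close>)
  have f: "f \<in> funs L" "length (map ?a ts) = fun_arity L f" using Fn.prems by simp_all
  have as: "set (map ?a ts) \<subseteq> prod_univ M" using IH by auto
  have "map (tm_val R (\<lambda>v. cls (u v))) ts = map cls (map ?a ts)" using IH by simp
  then have "tm_val R (\<lambda>v. cls (u v)) (Fn f ts) = fun_in R f (map cls (map ?a ts))"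
    by (simp del: map_map)
  also have "\<dots> = cls (\<lambda>n. fun_in (M n) f (map (\<lambda>a. a n) (map ?a ts)))"
    unfolding cls_def[abs_def]
    by (rule fun_in_reduced_product[OF is_ideal_Fin struct f(1) as f(2)])
  finally have val: "tm_val R (\<lambda>v. cls (u v)) (Fn f ts) = cls (?a (Fn f ts))"
    by (simp add: comp_def)
  have "?a (Fn f ts) n \<in> univ (M n)" for n
  proof -
    have "set (map (\<lambda>t. ?a t n) ts) \<subseteq> univ (M n)" using IH by (auto simp: prod_univ_def)
    then show ?thesis using struct[of n] f by (simp add: is_struct_def)
  qed
  then have "?a (Fn f ts) \<in> prod_univ M" by (simp add: prod_univ_def)
  then show ?case using val by (rule conjI)
qed

text \<open>Witnesses are chosen coordinate by coordinate; the finitely many exceptional coordinates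
  take the values of an arbitrary member of the product.\<close>

lemma bex_prod_univ_MOST_iff:
  "(\<exists>x\<in>prod_univ M. MOST n. P n (x n)) \<longleftrightarrow> (MOST n. \<exists>c\<in>univ (M n). P n c)"
proof
  assume "\<exists>x\<in>prod_univ M. MOST n. P n (x n)"
  then show "MOST n. \<exists>c\<in>univ (M n). P n c" by (auto simp: prod_univ_def elim!: MOST_mono)
next
  assume P: "MOST n. \<exists>c\<in>univ (M n). P n c"
  obtain z where z: "z \<in> prod_univ M" using prod_univ_nonempty by blast
  define x where "x n = (if \<exists>c\<in>univ (M n). P n c then SOME c. c \<in> univ (M n) \<and> P n c else z n)" for n
  have x: "x n \<in> univ (M n) \<and> P n (x n)" if "\<exists>c\<in>univ (M n). P n c" for n
    using that someI_ex[of "\<lambda>c. c \<in> univ (M n) \<and> P n c"] by (auto simp: x_def)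
  have "x n \<in> univ (M n)" for n
    using x z by (cases "\<exists>c\<in>univ (M n). P n c") (auto simp: x_def prod_univ_def)
  then have "x \<in> prod_univ M" by (simp add: prod_univ_def)
  moreover have "MOST n. P n (x n)" using P by (rule MOST_mono) (use x in blast)
  ultimately show "\<exists>x\<in>prod_univ M. MOST n. P n (x n)" by blast
qed

text \<open>Infinitely many coordinates are set aside for the failure of each \<open>\<psi> k\<close>.\<close>

lemma patch_counterexamples:
  fixes K :: "'k set"
  assumes "countable K" and ex: "MOST n. \<exists>c\<in>univ (M n). P n c"
    and fail: "\<And>k. k \<in> K \<Longrightarrow> INFM n. \<exists>c\<in>univ (M n). P n c \<and> \<not> \<psi> k n c"
  obtains x where "x \<in> prod_univ M" "MOST n. P n (x n)" "\<And>k. k \<in> K \<Longrightarrow> INFM n. \<not> \<psi> k n (x n)"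
proof -
  obtain lab :: "nat \<Rightarrow> 'k option" and st :: "nat \<Rightarrow> nat" where
    lab: "\<And>n k. lab n = Some k \<Longrightarrow> k \<in> K \<and> (\<exists>c\<in>univ (M n). P n c \<and> \<not> \<psi> k n c)"
    and inf: "\<And>k. k \<in> K \<Longrightarrow> INFM n. lab n = Some k"
    by (rule staged_disjoint_selection[OF assms(1),
          where P = "\<lambda>k s n. \<exists>c\<in>univ (M n). P n c \<and> \<not> \<psi> k n c"]) (erule fail, blast)
  have "MOST n. \<exists>c\<in>univ (M n). P n c \<and> (\<forall>k. lab n = Some k \<longrightarrow> \<not> \<psi> k n c)"
    using ex
  proof (rule MOST_mono)
    fix n assume "\<exists>c\<in>univ (M n). P n c"
    then show "\<exists>c\<in>univ (M n). P n c \<and> (\<forall>k. lab n = Some k \<longrightarrow> \<not> \<psi> k n c)"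
      using lab[of n] by (cases "lab n") auto
  qed
  then obtain x where x: "x \<in> prod_univ M"
      "MOST n. P n (x n) \<and> (\<forall>k. lab n = Some k \<longrightarrow> \<not> \<psi> k n (x n))"
    using bex_prod_univ_MOST_iff[of "\<lambda>n c. P n c \<and> (\<forall>k. lab n = Some k \<longrightarrow> \<not> \<psi> k n c)"] by auto
  have "INFM n. \<not> \<psi> k n (x n)" if "k \<in> K" for k
    using INFM_conjI[OF inf[OF that] x(2)] by (rule INFM_mono) auto
  moreover have "MOST n. P n (x n)" using x(2) by (rule MOST_mono) auto
  ultimately show ?thesis using that x(1) by blast
qed

lemma cls_env_upd: "(\<lambda>v. cls (u v))(m := cls x) = (\<lambda>v. cls ((u(m := x)) v))"
  by (simp add: fun_eq_iff)

lemma loc_env_upd: "(\<lambda>v. (u(m := x)) v n) = (\<lambda>v. u v n)(m := x n)"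
  by (simp add: fun_eq_iff)

lemma sat_R_Ex_iff:
  "sat R (\<lambda>v. cls (u v)) (Ex m \<phi>) \<longleftrightarrow>
    (\<exists>x\<in>prod_univ M. sat R (\<lambda>v. cls ((u(m := x)) v)) \<phi>)"
  by (simp only: sat.simps univ_R bex_simps cls_env_upd)

text \<open>Conjunction and \<exists> commute with truth at almost all coordinates. For
  \<open>himp\<close>, once \<open>\<phi>\<close> is solvable almost everywhere, a solution of
  \<open>\<phi>\<close> violating \<open>\<psi>\<close> in the product amounts to counterexamples at
  infinitely many coordinates. Negation by itself does not transfer: failing infinitely often is
  weaker than failing almost everywhere.\<close>

theorem h_formula_Los:
  assumes "h_formula L \<phi>" and "\<And>v. u v \<in> prod_univ M"
  shows "sat R (\<lambda>v. cls (u v)) \<phi> \<longleftrightarrow> (MOST n. loc_sat n (\<lambda>v. u v n) \<phi>)"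
  using assms
proof (induction arbitrary: u rule: h_formula.induct)
  case (h_Eq s t)
  then show ?case
    using tm_val_R[of u s] tm_val_R[of u t] by (simp add: cls_eq_iff)
next
  case (h_Rel r ts)
  let ?a = "\<lambda>t n. loc_val n (\<lambda>v. u v n) t"
  have a: "?a t \<in> prod_univ M \<and> tm_val R (\<lambda>v. cls (u v)) t = cls (?a t)" if "t \<in> set ts" for t
    by (rule tm_val_R) (use h_Rel that in simp_all)
  then have as: "set (map ?a ts) \<subseteq> prod_univ M" by auto
  have "map (tm_val R (\<lambda>v. cls (u v))) ts = map cls (map ?a ts)" using a by simp
  then have "sat R (\<lambda>v. cls (u v)) (Rel r ts) \<longleftrightarrow> rel_in R r (map cls (map ?a ts))"
    by (simp del: map_map)
  also have "\<dots> \<longleftrightarrow> {n. \<not> rel_in (M n) r (map (\<lambda>a. a n) (map ?a ts))} \<in> Fin"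
    unfolding cls_def[abs_def] by (rule rel_in_reduced_product[OF is_ideal_Fin as])
  finally show ?case by (simp add: Fin_def MOST_iff_cofinite comp_def)
next
  case (h_And \<phi> \<psi>)
  then show ?case by (simp add: MOST_conj_distrib)
next
  case (h_Ex \<phi> m)
  have "sat R (\<lambda>v. cls ((u(m := x)) v)) \<phi> \<longleftrightarrow> (MOST n. loc_sat n ((\<lambda>v. u v n)(m := x n)) \<phi>)"
    if "x \<in> prod_univ M" for x
    using h_Ex.IH[of "u(m := x)"] h_Ex.prems that unfolding loc_env_upd by simp
  then have "sat R (\<lambda>v. cls (u v)) (Ex m \<phi>) \<longleftrightarrow>
      (\<exists>x\<in>prod_univ M. MOST n. loc_sat n ((\<lambda>v. u v n)(m := x n)) \<phi>)"
    unfolding sat_R_Ex_iff by (intro bex_cong refl)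
  then show ?case
    using bex_prod_univ_MOST_iff[of "\<lambda>n c. loc_sat n ((\<lambda>v. u v n)(m := c)) \<phi>"] by simp
next
  case (h_himp \<phi> \<psi> m)
  let ?P = "\<lambda>\<chi> n c. loc_sat n ((\<lambda>v. u v n)(m := c)) \<chi>"
  have IH: "sat R (\<lambda>v. cls ((u(m := x)) v)) \<phi> \<longleftrightarrow> (MOST n. ?P \<phi> n (x n))"
      "sat R (\<lambda>v. cls ((u(m := x)) v)) \<psi> \<longleftrightarrow> (MOST n. ?P \<psi> n (x n))" if "x \<in> prod_univ M" for x
    using h_himp.IH(1)[of "u(m := x)"] h_himp.IH(2)[of "u(m := x)"] h_himp.prems that
    unfolding loc_env_upd by simp_all
  have ex_iff: "sat R (\<lambda>v. cls (u v)) (Ex m \<phi>) \<longleftrightarrow> (MOST n. \<exists>c\<in>univ (M n). ?P \<phi> n c)"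
    unfolding sat_R_Ex_iff bex_prod_univ_MOST_iff[of "?P \<phi>", symmetric]
    by (intro bex_cong refl IH(1))
  have fail_iff: "sat R (\<lambda>v. cls (u v)) (Ex m (And \<phi> (Neg \<psi>))) \<longleftrightarrow>
      (\<exists>x\<in>prod_univ M. (MOST n. ?P \<phi> n (x n)) \<and> \<not> (MOST n. ?P \<psi> n (x n)))"
    unfolding sat_R_Ex_iff by (intro bex_cong refl) (simp only: sat.simps IH)
  have patch: "(\<exists>x\<in>prod_univ M. (MOST n. ?P \<phi> n (x n)) \<and> \<not> (MOST n. ?P \<psi> n (x n))) \<longleftrightarrow>
      (INFM n. \<exists>c\<in>univ (M n). ?P \<phi> n c \<and> \<not> ?P \<psi> n c)"
    if ex: "MOST n. \<exists>c\<in>univ (M n). ?P \<phi> n c"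
  proof
    assume "\<exists>x\<in>prod_univ M. (MOST n. ?P \<phi> n (x n)) \<and> \<not> (MOST n. ?P \<psi> n (x n))"
    then obtain x where x: "x \<in> prod_univ M" "MOST n. ?P \<phi> n (x n)" "INFM n. \<not> ?P \<psi> n (x n)"
      unfolding not_MOST by blast
    then have "x n \<in> univ (M n)" for n by (auto simp: prod_univ_def)
    then show "INFM n. \<exists>c\<in>univ (M n). ?P \<phi> n c \<and> \<not> ?P \<psi> n c"
      using INFM_conjI[OF x(3,2)] by (elim INFM_mono) blast
  next
    assume fail: "INFM n. \<exists>c\<in>univ (M n). ?P \<phi> n c \<and> \<not> ?P \<psi> n c"
    \<comment> \<open>The index type \<open>unit\<close> stands for a single failure to be
      arranged.\<close>
    obtain x where "x \<in> prod_univ M" "MOST n. ?P \<phi> n (x n)"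
        "\<And>k :: unit. k \<in> UNIV \<Longrightarrow> INFM n. \<not> ?P \<psi> n (x n)"
      by (rule patch_counterexamples[where K = "UNIV :: unit set" and P = "?P \<phi>"
            and \<psi> = "\<lambda>_. ?P \<psi>", OF _ ex]) (simp, rule fail, blast)
    then show "\<exists>x\<in>prod_univ M. (MOST n. ?P \<phi> n (x n)) \<and> \<not> (MOST n. ?P \<psi> n (x n))"
      unfolding not_MOST by blast
  qed
  have "sat R (\<lambda>v. cls (u v)) (himp m \<phi> \<psi>) \<longleftrightarrow> (MOST n. \<exists>c\<in>univ (M n). ?P \<phi> n c) \<and>
      \<not> (INFM n. \<exists>c\<in>univ (M n). ?P \<phi> n c \<and> \<not> ?P \<psi> n c)"
    unfolding sat.simps(3,4) ex_iff fail_iff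
    by (rule conj_cong[OF refl], rule arg_cong[where f = Not], rule patch)
  then show ?case by (simp only: loc_sat_simps not_INFM MOST_conj_distrib)
qed

text \<open>Each negation is met on its own infinite set of coordinates, so countably many of them
  that are separately compatible with \<open>\<phi>\<close> are jointly compatible. Compatibility
  with a single one is the failure of an h-formula.\<close>

lemma realise_h_formula_and_negations:
  assumes e: "range e \<subseteq> univ R" and \<phi>: "h_formula L \<phi>"
    and "countable K" and K: "\<And>\<chi>. \<chi> \<in> K \<Longrightarrow> h_formula L \<chi>"
    and ex: "sat R e (Ex m \<phi>)" and fail: "\<And>\<chi>. \<chi> \<in> K \<Longrightarrow> \<not> sat R e (himp m \<phi> \<chi>)"
  shows "\<exists>a\<in>univ R. sat R (e(m := a)) \<phi> \<and> (\<forall>\<chi>\<in>K. \<not> sat R (e(m := a)) \<chi>)"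
proof -
  obtain u where u: "\<And>v. u v \<in> prod_univ M" "e = (\<lambda>v. cls (u v))" by (rule lift_env[OF e]) blast
  let ?P = "\<lambda>\<chi> n c. loc_sat n ((\<lambda>v. u v n)(m := c)) \<chi>"
  have Los: "sat R (e(m := cls x)) \<chi> \<longleftrightarrow> (MOST n. ?P \<chi> n (x n))"
    if "x \<in> prod_univ M" "h_formula L \<chi>" for x \<chi>
  proof -
    have "(u(m := x)) v \<in> prod_univ M" for v using u that by simp
    then have "sat R (\<lambda>v. cls ((u(m := x)) v)) \<chi> \<longleftrightarrow> (MOST n. loc_sat n (\<lambda>v. (u(m := x)) v n) \<chi>)"
      by (rule h_formula_Los[OF that(2)])
    then show ?thesis by (simp only: u(2) cls_env_upd loc_env_upd)
  qed
  have ex': "MOST n. \<exists>c\<in>univ (M n). ?P \<phi> n c"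
    using ex h_formula_Los[OF h_Ex[OF \<phi>, of m], of u] u(1) by (simp add: u(2))
  have fail': "INFM n. \<exists>c\<in>univ (M n). ?P \<phi> n c \<and> \<not> ?P \<chi> n c" if "\<chi> \<in> K" for \<chi>
  proof -
    have "sat R e (himp m \<phi> \<chi>) \<longleftrightarrow> (MOST n. loc_sat n (\<lambda>v. u v n) (himp m \<phi> \<chi>))"
      unfolding u(2) by (rule h_formula_Los[OF h_himp[OF \<phi> K[OF that]] u(1)])
    then have "INFM n. \<not> loc_sat n (\<lambda>v. u v n) (himp m \<phi> \<chi>)"
      using fail[OF that] unfolding not_MOST[symmetric] by (simp only: not_False_eq_True)
    from INFM_conjI[OF this ex'] show ?thesis
      by (rule INFM_mono) auto
  qed
  obtain x where "x \<in> prod_univ M" "MOST n. ?P \<phi> n (x n)" "\<And>\<chi>. \<chi> \<in> K \<Longrightarrow> INFM n. \<not> ?P \<chi> n (x n)"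
    by (rule patch_counterexamples[OF \<open>countable K\<close> ex', where \<psi> = ?P]) (erule fail', blast)
  then show ?thesis using Los \<phi> K by (intro bexI[of _ "cls x"]) (auto simp: univ_R)
qed

text \<open>For finite \<open>H\<close> this is a semantic form of being equivalent in the product
  to a Boolean combination of members of \<open>H\<close>. Comparing assignments avoids writing
  normal forms.\<close>

definition determines :: "('f, 'r, (nat \<Rightarrow> 'a) set) fm set \<Rightarrow> ('f, 'r, (nat \<Rightarrow> 'a) set) fm \<Rightarrow> bool" where
  "determines H \<phi> \<longleftrightarrow> (\<forall>e e'. range e \<subseteq> univ R \<longrightarrow> range e' \<subseteq> univ R \<longrightarrow>
    (\<forall>\<chi>\<in>H. sat R e \<chi> \<longleftrightarrow> sat R e' \<chi>) \<longrightarrow> (sat R e \<phi> \<longleftrightarrow> sat R e' \<phi>))"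

lemma determinesD:
  assumes "determines H \<phi>" "range e \<subseteq> univ R" "range e' \<subseteq> univ R"
    "\<And>\<chi>. \<chi> \<in> H \<Longrightarrow> sat R e \<chi> \<longleftrightarrow> sat R e' \<chi>"
  shows "sat R e \<phi> \<longleftrightarrow> sat R e' \<phi>"
  using assms unfolding determines_def by blast

lemma determines_Neg: "determines H (Neg \<phi>) \<longleftrightarrow> determines H \<phi>"
  unfolding determines_def sat.simps by (intro all_cong1 imp_cong refl) blast

text \<open>The truth of \<open>Ex m \<phi>\<close> depends on which subsets \<open>P\<close> of
  \<open>H\<close> are exactly the members true at some value of the variable. By
  \<open>realise_h_formula_and_negations\<close> this can be read off from h-formulas: the
  conjunction of \<open>P\<close> must be solvable, and \<open>himp\<close> from it to each member
  of \<open>H - P\<close> must fail.\<close>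

lemma determines_Ex:
  assumes H: "finite H" "\<And>\<chi>. \<chi> \<in> H \<Longrightarrow> h_formula L \<chi>" and det: "determines H \<phi>"
  shows "\<exists>H'. finite H' \<and> (\<forall>\<chi>\<in>H'. h_formula L \<chi>) \<and> determines H' (Ex m \<phi>)"
proof -
  have "\<forall>P\<in>Pow H. \<exists>\<theta>. h_formula L \<theta> \<and>
    (\<forall>(M :: ('f, 'r, (nat \<Rightarrow> 'a) set) struct) e. sat M e \<theta> \<longleftrightarrow> (\<forall>\<chi>\<in>P. sat M e \<chi>))"
  proof
    fix P assume "P \<in> Pow H"
    then have "P \<subseteq> H" by simp
    then show "\<exists>\<theta>. h_formula L \<theta> \<and>
        (\<forall>(M :: ('f, 'r, (nat \<Rightarrow> 'a) set) struct) e. sat M e \<theta> \<longleftrightarrow> (\<forall>\<chi>\<in>P. sat M e \<chi>))"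
      by (intro h_formula_conjunction[OF finite_subset[OF _ H(1)] H(2)]) blast+
  qed
  from bchoice[OF this] obtain cj where cj: "\<forall>P\<in>Pow H. h_formula L (cj P) \<and>
    (\<forall>(M :: ('f, 'r, (nat \<Rightarrow> 'a) set) struct) e. sat M e (cj P) \<longleftrightarrow> (\<forall>\<chi>\<in>P. sat M e \<chi>))" ..
  have cj_h: "h_formula L (cj P)" and sat_cj: "sat R e (cj P) \<longleftrightarrow> (\<forall>\<chi>\<in>P. sat R e \<chi>)"
    if "P \<subseteq> H" for P e
    using cj that by simp_all
  define H' where "H' = (\<lambda>P. Ex m (cj P)) ` Pow H \<union> (\<lambda>(P, \<chi>). himp m (cj P) \<chi>) ` (Pow H \<times> H)"
  have step: "sat R e' (Ex m \<phi>)"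
    if e: "range e \<subseteq> univ R" "range e' \<subseteq> univ R" and agree: "\<forall>\<chi>\<in>H'. sat R e \<chi> \<longleftrightarrow> sat R e' \<chi>"
      and sat: "sat R e (Ex m \<phi>)" for e e'
  proof -
    obtain a where a: "a \<in> univ R" "sat R (e(m := a)) \<phi>" using sat unfolding sat.simps(5) by blast
    define P where "P = {\<chi>\<in>H. sat R (e(m := a)) \<chi>}"
    have P: "P \<subseteq> H" by (simp add: P_def)
    have aP: "sat R (e(m := a)) (cj P)" unfolding sat_cj[OF P] by (simp add: P_def)
    have "Ex m (cj P) \<in> H'" using P unfolding H'_def by blast
    moreover have "sat R e (Ex m (cj P))" using aP a(1) unfolding sat.simps(5) by blast
    ultimately have ex: "sat R e' (Ex m (cj P))" using agree by blast
    have fail: "\<not> sat R e' (himp m (cj P) \<chi>)" if "\<chi> \<in> H - P" for \<chi>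
    proof -
      have "\<not> sat R (e(m := a)) \<chi>" using that by (simp add: P_def)
      then have "\<not> sat R e (himp m (cj P) \<chi>)" using aP a(1) unfolding sat.simps(3-5) by blast
      moreover have "himp m (cj P) \<chi> \<in> H'"
        unfolding H'_def by (rule UnI2, rule image_eqI[of _ _ "(P, \<chi>)"]) (use P that in simp_all)
      ultimately show ?thesis using agree by blast
    qed
    \<comment> \<open>\<open>b\<close> satisfies under \<open>e'\<close> the same members of
      \<open>H\<close> as \<open>a\<close> under \<open>e\<close>.\<close>
    have "\<exists>b\<in>univ R. sat R (e'(m := b)) (cj P) \<and> (\<forall>\<chi>\<in>H - P. \<not> sat R (e'(m := b)) \<chi>)"
      by (rule realise_h_formula_and_negations[OF e(2) cj_h[OF P] _ _ ex fail])
        (use H in \<open>simp_all add: countable_finite\<close>)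
    then obtain b where b: "b \<in> univ R" "sat R (e'(m := b)) (cj P)"
        "\<forall>\<chi>\<in>H - P. \<not> sat R (e'(m := b)) \<chi>" by blast
    have "sat R (e(m := a)) \<chi> \<longleftrightarrow> sat R (e'(m := b)) \<chi>" if "\<chi> \<in> H" for \<chi>
      using b(2,3) that unfolding sat_cj[OF P] by (cases "\<chi> \<in> P") (simp_all add: P_def)
    moreover have "range (e(m := a)) \<subseteq> univ R" "range (e'(m := b)) \<subseteq> univ R"
      using e a(1) b(1) by (auto simp: image_subset_iff)
    ultimately have "sat R (e'(m := b)) \<phi>" using determinesD[OF det] a(2) by blast
    then show ?thesis using b(1) unfolding sat.simps(5) by blast
  qed
  have "determines H' (Ex m \<phi>)"
    unfolding determines_def
  proof (intro allI impI)
    fix e e' assume e: "range e \<subseteq> univ R" "range e' \<subseteq> univ R"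
      and agree: "\<forall>\<chi>\<in>H'. sat R e \<chi> \<longleftrightarrow> sat R e' \<chi>"
    then have agree': "\<forall>\<chi>\<in>H'. sat R e' \<chi> \<longleftrightarrow> sat R e \<chi>" by simp
    show "sat R e (Ex m \<phi>) \<longleftrightarrow> sat R e' (Ex m \<phi>)"
      by (rule iffI[OF step[OF e agree] step[OF e(2,1) agree']])
  qed
  moreover have "finite H'" using H(1) by (simp add: H'_def)
  moreover have "\<forall>\<chi>\<in>H'. h_formula L \<chi>"
  proof
    fix \<chi> assume "\<chi> \<in> H'"
    then have "(\<exists>P\<in>Pow H. \<chi> = Ex m (cj P)) \<or> (\<exists>P\<in>Pow H. \<exists>\<theta>\<in>H. \<chi> = himp m (cj P) \<theta>)"
      by (auto simp: H'_def)
    then show "h_formula L \<chi>"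
      by (elim disjE bexE) (simp_all only: h_Ex h_himp cj_h H(2) Pow_iff)
  qed
  ultimately show ?thesis by (intro exI[of _ H'] conjI)
qed

text \<open>A semantic form of quantifier elimination down to Boolean combinations of h-formulas.\<close>

theorem determined_by_h_formulas:
  assumes "fm_wf L \<phi>" "fm_params \<phi> = {}"
  shows "\<exists>H. finite H \<and> (\<forall>\<chi>\<in>H. h_formula L \<chi>) \<and> determines H \<phi>"
  using assms
proof (induction \<phi>)
  case (Eq s t)
  then have "h_formula L (Eq s t)" by (simp add: h_Eq)
  then show ?case by (intro exI[of _ "{Eq s t}"]) (simp add: determines_def)
next
  case (Rel r ts)
  then have "h_formula L (Rel r ts)" by (intro h_Rel) (simp_all add: list_all_iff)
  then show ?case by (intro exI[of _ "{Rel r ts}"]) (simp add: determines_def)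
next
  case (Neg \<phi>)
  then show ?case by (simp add: determines_Neg)
next
  case (And \<phi> \<psi>)
  then have wf: "fm_wf L \<phi>" "fm_params \<phi> = {}" "fm_wf L \<psi>" "fm_params \<psi> = {}" by simp_all
  obtain H where H: "finite H" "\<forall>\<chi>\<in>H. h_formula L \<chi>" "determines H \<phi>"
    using And.IH(1)[OF wf(1,2)] by blast
  obtain H' where H': "finite H'" "\<forall>\<chi>\<in>H'. h_formula L \<chi>" "determines H' \<psi>"
    using And.IH(2)[OF wf(3,4)] by blast
  have "determines (H \<union> H') (And \<phi> \<psi>)"
    unfolding determines_def
  proof (intro allI impI)
    fix e e' assume e: "range e \<subseteq> univ R" "range e' \<subseteq> univ R"
      and "\<forall>\<chi>\<in>H \<union> H'. sat R e \<chi> \<longleftrightarrow> sat R e' \<chi>"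
    then show "sat R e (And \<phi> \<psi>) \<longleftrightarrow> sat R e' (And \<phi> \<psi>)"
      using determinesD[OF H(3) e] determinesD[OF H'(3) e] by simp
  qed
  moreover have "finite (H \<union> H')" "\<forall>\<chi>\<in>H \<union> H'. h_formula L \<chi>"
    using H(1,2) H'(1,2) by (simp_all add: ball_Un)
  ultimately show ?case by (intro exI[of _ "H \<union> H'"] conjI)
next
  case (Ex m \<phi>)
  then have "\<exists>H. finite H \<and> (\<forall>\<chi>\<in>H. h_formula L \<chi>) \<and> determines H \<phi>" by simp
  then obtain H where H: "finite H" "\<forall>\<chi>\<in>H. h_formula L \<chi>" "determines H \<phi>" by blast
  then show ?case by (intro determines_Ex[OF H(1) _ H(3)]) blast
qed

end

section \<open>Stability makes h-formulas normal\<close>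

context fin_reduced_product
begin

text \<open>If the fourth combination failed infinitely often, mixing \<open>c\<close> with
  \<open>d\<close> and \<open>\<beta>\<close> with \<open>\<gamma>\<close> over infinitely many
  disjoint infinite sets of coordinates would code the order of the natural numbers, against
  stability.\<close>

lemma h_formula_normal_sequences:
  assumes stable: "stable L (Th L R)" and \<chi>: "h_formula L \<chi>"
    and u: "\<And>v. \<beta> v \<in> prod_univ M" "\<And>v. \<gamma> v \<in> prod_univ M" "c \<in> prod_univ M" "d \<in> prod_univ M"
    and c\<beta>: "MOST n. loc_sat n ((\<lambda>v. \<beta> v n)(0 := c n)) \<chi>"
    and c\<gamma>: "MOST n. loc_sat n ((\<lambda>v. \<gamma> v n)(0 := c n)) \<chi>"
    and d\<beta>: "MOST n. loc_sat n ((\<lambda>v. \<beta> v n)(0 := d n)) \<chi>"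
  shows "MOST n. loc_sat n ((\<lambda>v. \<gamma> v n)(0 := d n)) \<chi>"
proof (rule ccontr)
  assume "\<not> ?thesis"
  then have bad: "INFM n. \<not> loc_sat n ((\<lambda>v. \<gamma> v n)(0 := d n)) \<chi>" by simp
  obtain lab :: "nat \<Rightarrow> nat option" and st :: "nat \<Rightarrow> nat" where
    lab: "\<And>n k. lab n = Some k \<Longrightarrow> k \<in> UNIV \<and> \<not> loc_sat n ((\<lambda>v. \<gamma> v n)(0 := d n)) \<chi>"
    and inf: "\<And>k. k \<in> UNIV \<Longrightarrow> INFM n. lab n = Some k"
    by (rule staged_disjoint_selection[where K = "UNIV :: nat set"
          and P = "\<lambda>_ _ n. \<not> loc_sat n ((\<lambda>v. \<gamma> v n)(0 := d n)) \<chi>"]) (simp, rule bad, blast)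
  \<comment> \<open>At label \<open>k\<close> the bad combination of \<open>d\<close> with
    \<open>\<gamma>\<close> arises iff \<open>j \<le> k\<close> and \<open>k < i\<close>. Such a
    label exists iff \<open>j < i\<close>, so \<open>\<chi>\<close> holds of \<open>x i\<close> and
    \<open>y j\<close> iff \<open>i \<le> j\<close>.\<close>
  define x where "x i n = (case lab n of None \<Rightarrow> c n | Some k \<Rightarrow> if k < i then d n else c n)" for i n
  define y where "y j v n = (case lab n of None \<Rightarrow> \<beta> v n | Some k \<Rightarrow> if j \<le> k then \<gamma> v n else \<beta> v n)"
    for j v n
  have x: "x i \<in> prod_univ M" for i
    using u(3,4) by (auto simp: x_def prod_univ_def Pi_def split: option.split)
  have y: "y j v \<in> prod_univ M" for j v
    using u(1,2)[of v] by (auto simp: y_def prod_univ_def Pi_def split: option.split)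
  have yx: "((y j)(0 := x i)) v \<in> prod_univ M" for i j v using x y by simp
  have Los: "sat R (\<lambda>v. cls (((y j)(0 := x i)) v)) \<chi> \<longleftrightarrow> i \<le> j" for i j
  proof -
    have "(MOST n. loc_sat n ((\<lambda>v. y j v n)(0 := x i n)) \<chi>) \<longleftrightarrow> i \<le> j"
    proof (cases "i \<le> j")
      case True
      have "loc_sat n ((\<lambda>v. y j v n)(0 := x i n)) \<chi>"
        if "loc_sat n ((\<lambda>v. \<beta> v n)(0 := c n)) \<chi>" "loc_sat n ((\<lambda>v. \<gamma> v n)(0 := c n)) \<chi>"
          "loc_sat n ((\<lambda>v. \<beta> v n)(0 := d n)) \<chi>" for n
      proof (cases "lab n")
        case None
        then show ?thesis using that(1) by (simp add: x_def y_def)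
      next
        case (Some k)
        then show ?thesis using that True
          by (cases "k < i"; cases "j \<le> k") (simp_all add: x_def y_def)
      qed
      then have "MOST n. loc_sat n ((\<lambda>v. y j v n)(0 := x i n)) \<chi>"
        using MOST_conjI[OF c\<beta> MOST_conjI[OF c\<gamma> d\<beta>]] by (elim MOST_mono) blast
      then show ?thesis using True by simp
    next
      case False
      have "\<not> loc_sat n ((\<lambda>v. y j v n)(0 := x i n)) \<chi>" if "lab n = Some j" for n
        using that False lab[OF that] by (simp add: x_def y_def)
      then have "INFM n. \<not> loc_sat n ((\<lambda>v. y j v n)(0 := x i n)) \<chi>"
        by (rule INFM_mono[OF inf[OF UNIV_I, of j]])
      then show ?thesis using False unfolding not_MOST[symmetric] by (simp only: simp_thms)
    qed
    then show ?thesis unfolding h_formula_Los[OF \<chi> yx] loc_env_upd .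
  qed
  obtain N where N: "fm_vars \<chi> \<subseteq> {..<N}"
    using finite_nat_bounded[OF finite_fm_vars[of \<chi>]] ..
  define a where "a i = [cls (x i)]" for i
  \<comment> \<open>Variable \<open>0\<close> forms the first tuple, of length 1; the variables from
    \<open>1\<close> to \<open>N\<close> form the second.\<close>
  define b where "b j = map (\<lambda>v. cls (y j v)) [1..<Suc N]" for j
  have "sat R ((!) (a i @ b j)) \<chi> \<longleftrightarrow> sat R (\<lambda>v. cls (((y j)(0 := x i)) v)) \<chi>" for i j
  proof (rule sat_cong)
    fix v assume "v \<in> fm_vars \<chi>"
    then have "v < N" using N by auto
    then show "(a i @ b j) ! v = cls (((y j)(0 := x i)) v)"
      by (cases v) (simp_all add: a_def b_def nth_append del: upt_Suc)
  qed
  then have sat: "sat R ((!) (a i @ b j)) \<chi> \<longleftrightarrow> i \<le> j" for i j using Los by simp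
  have "order_property L (Th L R) 1 N \<chi>"
    unfolding order_property_def
  proof (intro allI exI conjI impI)
    show "is_model L (Th L R) R" by (rule is_model_R)
    show "length (a i) = 1" "length (b i) = N" for i by (simp_all add: a_def b_def)
    show "set (a i) \<subseteq> univ R" "set (b i) \<subseteq> univ R" for i
      using x y by (auto simp: a_def b_def univ_R)
    show "sat R ((!) (a i @ b j)) \<chi> \<longleftrightarrow> i \<le> j" for i j by (rule sat)
  qed
  moreover have "fm_vars \<chi> \<subseteq> {..<1 + N}" using N by auto
  ultimately show False using stable h_formula_wf[OF \<chi>] unfolding stable_def by blast
qed

text \<open>Satisfiability in \<open>R\<close> is needed: otherwise \<open>\<chi>\<close> may define nothing on infinitely many
  coordinates and be arbitrary on the others.\<close>

lemma h_formula_normal: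
  assumes stable: "stable L (Th L R)" and \<chi>: "h_formula L \<chi>"
    and sat: "range e \<subseteq> univ R" "sat R e \<chi>"
  shows "MOST n. \<forall>c\<in>univ (M n). \<forall>d\<in>univ (M n).
    \<forall>\<beta>\<in>{\<epsilon>. range \<epsilon> \<subseteq> univ (M n)}. \<forall>\<gamma>\<in>{\<epsilon>. range \<epsilon> \<subseteq> univ (M n)}.
      loc_sat n (\<beta>(0 := c)) \<chi> \<longrightarrow> loc_sat n (\<gamma>(0 := c)) \<chi> \<longrightarrow>
      loc_sat n (\<beta>(0 := d)) \<chi> \<longrightarrow> loc_sat n (\<gamma>(0 := d)) \<chi>"
proof -
  obtain u where u: "\<And>v. u v \<in> prod_univ M" "e = (\<lambda>v. cls (u v))"
    by (rule lift_env[OF sat(1)]) blast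
  then have u_sat: "MOST n. loc_sat n (\<lambda>v. u v n) \<chi>"
    using sat(2) h_formula_Los[OF \<chi> u(1)] by simp
  have u_n: "u v n \<in> univ (M n)" for v n using u(1)[of v] by (auto simp: prod_univ_def)
  define counter where "counter n c d \<beta> \<gamma> \<longleftrightarrow> c \<in> univ (M n) \<and> d \<in> univ (M n) \<and>
      range \<beta> \<subseteq> univ (M n) \<and> range \<gamma> \<subseteq> univ (M n) \<and>
      loc_sat n (\<beta>(0 := c)) \<chi> \<and> loc_sat n (\<gamma>(0 := c)) \<chi> \<and>
      loc_sat n (\<beta>(0 := d)) \<chi> \<and> \<not> loc_sat n (\<gamma>(0 := d)) \<chi>" for n c d \<beta> \<gamma>
  \<comment> \<open>A counterexample is taken wherever there is one, and \<open>u\<close> paired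
    with itself elsewhere. Since \<open>u\<close> satisfies \<open>\<chi>\<close> almost everywhere,
    the three premises of \<open>h_formula_normal_sequences\<close> then hold almost
    everywhere.\<close>
  have "\<exists>q. case q of (c, d, \<beta>, \<gamma>) \<Rightarrow> c \<in> univ (M n) \<and> d \<in> univ (M n) \<and>
      range \<beta> \<subseteq> univ (M n) \<and> range \<gamma> \<subseteq> univ (M n) \<and>
      (loc_sat n (\<lambda>v. u v n) \<chi> \<longrightarrow> loc_sat n (\<beta>(0 := c)) \<chi> \<and> loc_sat n (\<gamma>(0 := c)) \<chi> \<and>
        loc_sat n (\<beta>(0 := d)) \<chi>) \<and>
      ((\<exists>c d \<beta> \<gamma>. counter n c d \<beta> \<gamma>) \<longrightarrow> \<not> loc_sat n (\<gamma>(0 := d)) \<chi>)" for n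
  proof (cases "\<exists>c d \<beta> \<gamma>. counter n c d \<beta> \<gamma>")
    case True
    then obtain c d \<beta> \<gamma> where "counter n c d \<beta> \<gamma>" by blast
    then show ?thesis by (intro exI[of _ "(c, d, \<beta>, \<gamma>)"]) (simp add: counter_def)
  next
    case False
    have "(\<lambda>v. u v n)(0 := u 0 n) = (\<lambda>v. u v n)" by (simp add: fun_eq_iff)
    then show ?thesis using False u_n
      by (intro exI[of _ "(u 0 n, u 0 n, \<lambda>v. u v n, \<lambda>v. u v n)"]) (simp add: image_subset_iff)
  qed
  then have "\<forall>n. \<exists>q. case q of (c, d, \<beta>, \<gamma>) \<Rightarrow> c \<in> univ (M n) \<and> d \<in> univ (M n) \<and>
      range \<beta> \<subseteq> univ (M n) \<and> range \<gamma> \<subseteq> univ (M n) \<and>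
      (loc_sat n (\<lambda>v. u v n) \<chi> \<longrightarrow> loc_sat n (\<beta>(0 := c)) \<chi> \<and> loc_sat n (\<gamma>(0 := c)) \<chi> \<and>
        loc_sat n (\<beta>(0 := d)) \<chi>) \<and>
      ((\<exists>c d \<beta> \<gamma>. counter n c d \<beta> \<gamma>) \<longrightarrow> \<not> loc_sat n (\<gamma>(0 := d)) \<chi>)" ..
  from choice[OF this] obtain q where q: "\<forall>n. case q n of (c, d, \<beta>, \<gamma>) \<Rightarrow>
      c \<in> univ (M n) \<and> d \<in> univ (M n) \<and> range \<beta> \<subseteq> univ (M n) \<and> range \<gamma> \<subseteq> univ (M n) \<and>
      (loc_sat n (\<lambda>v. u v n) \<chi> \<longrightarrow> loc_sat n (\<beta>(0 := c)) \<chi> \<and> loc_sat n (\<gamma>(0 := c)) \<chi> \<and>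
        loc_sat n (\<beta>(0 := d)) \<chi>) \<and>
      ((\<exists>c d \<beta> \<gamma>. counter n c d \<beta> \<gamma>) \<longrightarrow> \<not> loc_sat n (\<gamma>(0 := d)) \<chi>)" ..
  define c where "c n = fst (q n)" for n
  define d where "d n = fst (snd (q n))" for n
  define \<beta> where "\<beta> v n = fst (snd (snd (q n))) v" for v n
  define \<gamma> where "\<gamma> v n = snd (snd (snd (q n))) v" for v n
  have q': "c n \<in> univ (M n)" "d n \<in> univ (M n)"
      "range (\<lambda>v. \<beta> v n) \<subseteq> univ (M n)" "range (\<lambda>v. \<gamma> v n) \<subseteq> univ (M n)"
      "loc_sat n (\<lambda>v. u v n) \<chi> \<Longrightarrow> loc_sat n ((\<lambda>v. \<beta> v n)(0 := c n)) \<chi>"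
      "loc_sat n (\<lambda>v. u v n) \<chi> \<Longrightarrow> loc_sat n ((\<lambda>v. \<gamma> v n)(0 := c n)) \<chi>"
      "loc_sat n (\<lambda>v. u v n) \<chi> \<Longrightarrow> loc_sat n ((\<lambda>v. \<beta> v n)(0 := d n)) \<chi>"
      "\<exists>c d \<beta> \<gamma>. counter n c d \<beta> \<gamma> \<Longrightarrow> \<not> loc_sat n ((\<lambda>v. \<gamma> v n)(0 := d n)) \<chi>" for n
    using spec[OF q, of n] by (simp_all add: c_def d_def \<beta>_def \<gamma>_def split_beta)
  have prods: "\<beta> v \<in> prod_univ M" "\<gamma> v \<in> prod_univ M" "c \<in> prod_univ M" "d \<in> prod_univ M" for v
    using q'(1,2) range_subsetD[OF q'(3)] range_subsetD[OF q'(4)] by (simp_all add: prod_univ_def)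
  have "MOST n. loc_sat n ((\<lambda>v. \<gamma> v n)(0 := d n)) \<chi>"
    by (rule h_formula_normal_sequences[OF stable \<chi> prods MOST_mono[OF u_sat q'(5)]
          MOST_mono[OF u_sat q'(6)] MOST_mono[OF u_sat q'(7)]])
  then have "MOST n. \<not> (\<exists>c d \<beta> \<gamma>. counter n c d \<beta> \<gamma>)"
    by (rule MOST_mono) (rule notI, drule q'(8), erule notE)
  then show ?thesis by (rule MOST_mono) (unfold counter_def, blast)
qed

section \<open>Saturation\<close>

theorem card_saturated_continuum:
  assumes L: "countable_language L" and stable: "stable L (Th L R)"
  shows "card_saturated L continuum R"
  unfolding card_saturated_def
proof (intro allI impI)
  fix X p assume "X \<subseteq> univ R \<and> |X| <o continuum \<and> is_type L R X p"
  then have X: "X \<subseteq> univ R" "|X| <o continuum" and p: "is_type L R X p" by simp_all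

  \<comment> \<open>Completing the type by an ultrafilter\<close>
  obtain d where d: "d \<in> univ R" using is_struct_R unfolding is_struct_def by blast
  \<comment> \<open>\<open>d\<close> is the default value of the assignments coded by lists; adding
    it to the parameters keeps the cardinal bound.\<close>
  define X' where "X' = insert d X"
  have X': "X' \<subseteq> univ R" "d \<in> X'" "X \<subseteq> X'" using X d by (auto simp: X'_def)
  have card_X': "|X'| <o continuum"
  proof (cases "finite X")
    case True
    then show ?thesis by (intro countable_ordLess_continuum) (simp add: X'_def countable_finite)
  next
    case False
    then have "|{d}| \<le>o |X|" by (intro card_of_singl_ordLeq infinite_imp_nonempty)
    then have "|{d} \<union> X| \<le>o |X|"
      by (intro card_of_Un_ordLeq_infinite_Field ordLeq_refl card_of_Card_order)
        (simp add: Field_card_of False)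
    then have "|X'| \<le>o |X|" by (simp add: X'_def)
    then show ?thesis using X(2) by (rule ordLeq_ordLess_trans)
  qed
  define env where "env l = list_env d l" for l
  have env: "range (env l) \<subseteq> univ R" if "l \<in> lists X'" for l
  proof -
    have "set l \<subseteq> univ R" using that X'(1) by auto
    then have "env l i \<in> univ R" for i
      using d nth_mem[of i l] by (auto simp: env_def list_env_def)
    then show ?thesis by blast
  qed
  define inst where "inst \<phi> l = {a\<in>univ R. sat R ((env l)(0 := a)) \<phi>}" for \<phi> l
  \<comment> \<open>\<open>U\<close> will live on the whole type of elements; putting the universe
    into \<open>F\<close> keeps witnesses inside the structure.\<close>
  define F where "F = insert (univ R) ((\<lambda>\<phi>. {a\<in>univ R. sat R (\<lambda>_. a) \<phi>}) ` p)"
  have F_fip: "\<Inter>Q \<noteq> {}" if Q: "finite Q" "Q \<subseteq> F" for Q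
  proof -
    have "Q - {univ R} \<subseteq> (\<lambda>\<phi>. {a\<in>univ R. sat R (\<lambda>_. a) \<phi>}) ` p" using Q(2) by (auto simp: F_def)
    then obtain q where q: "q \<subseteq> p" "finite q" "Q - {univ R} = (\<lambda>\<phi>. {a\<in>univ R. sat R (\<lambda>_. a) \<phi>}) ` q"
      using finite_subset_image[OF finite_Diff[OF Q(1)]] by meson
    then obtain a where a: "realises R a q" using p unfolding is_type_def by meson
    have "a \<in> Y" if "Y \<in> Q" for Y
    proof (cases "Y = univ R")
      case True
      then show ?thesis using a by (simp add: realises_def)
    next
      case False
      then have "Y \<in> (\<lambda>\<phi>. {a\<in>univ R. sat R (\<lambda>_. a) \<phi>}) ` q" using that q(3) by blast
      then show ?thesis using a by (auto simp: realises_def)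
    qed
    then have "a \<in> \<Inter>Q" by (rule InterI)
    then show ?thesis by (metis empty_iff)
  qed
  obtain U where U: "F \<subseteq> U \<and> (\<forall>Q. finite Q \<and> Q \<subseteq> U \<longrightarrow> \<Inter>Q \<noteq> {}) \<and> (\<forall>B. B \<in> U \<or> - B \<in> U)"
    using finite_intersections_extend_to_ultrafilter[OF F_fip] ..
  then have F: "F \<subseteq> U" and fip: "\<And>Q. finite Q \<Longrightarrow> Q \<subseteq> U \<Longrightarrow> \<Inter>Q \<noteq> {}"
      and ultra: "\<And>B. B \<in> U \<or> - B \<in> U"
    by simp_all
  have witness: "\<exists>a\<in>univ R. (\<forall>Y\<in>Q. a \<in> Y) \<and> (\<forall>Y\<in>Q'. a \<notin> Y)"
    if "finite Q" "Q \<subseteq> U" "finite Q'" "\<And>Y. Y \<in> Q' \<Longrightarrow> Y \<notin> U" for Q Q'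
  proof -
    have "insert (univ R) (Q \<union> uminus ` Q') \<subseteq> U"
      using that(2,4) F ultra by (auto simp: F_def)
    then have "\<Inter>(insert (univ R) (Q \<union> uminus ` Q')) \<noteq> {}"
      using that(1,3) by (intro fip) simp_all
    then obtain a where "a \<in> \<Inter>(insert (univ R) (Q \<union> uminus ` Q'))" by (metis all_not_in_conv)
    then show ?thesis by (intro bexI[of _ a]) auto
  qed

  \<comment> \<open>Conditions on sequences of coordinates\<close>
  define H where "H = {\<chi>. h_formula L \<chi> \<and> (\<exists>e. range e \<subseteq> univ R \<and> sat R e \<chi>)}"
  have H: "countable H"
    by (rule countable_subset[OF _ countable_parameter_free_formulas[OF L]])
      (auto simp: H_def dest: h_formula_wf)
  define A where "A n = univ (M n)" for n
  define B where "B n = {\<epsilon> :: nat \<Rightarrow> 'a. range \<epsilon> \<subseteq> univ (M n)}" for n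
  \<comment> \<open>Whole assignments play the part of the parameter \<open>\<beta>\<close>, with
    variable \<open>0\<close> overwritten by the element tested.\<close>
  define Q where "Q \<chi> n \<beta> c \<longleftrightarrow> loc_sat n (\<beta>(0 := c)) \<chi>" for \<chi> n \<beta> and c :: 'a
  define loc where "loc l n v = rep (env l v) n" for l n v
  have env_rep: "rep (env l v) \<in> prod_univ M \<and> cls (rep (env l v)) = env l v" if "l \<in> lists X'" for l v
    by (rule rep_in_prod_univ_and_cls_rep[OF range_subsetD[OF env[OF that]]])
  have loc: "loc l \<in> (\<Pi> n\<in>UNIV. B n)" if "l \<in> lists X'" for l
  proof (rule Pi_I)
    fix n
    have "loc l n v \<in> univ (M n)" for v
      using env_rep[OF that, of v] by (auto simp: loc_def prod_univ_def)
    then show "loc l n \<in> B n" by (auto simp: B_def)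
  qed
  have inst_iff: "cls x \<in> inst \<chi> l \<longleftrightarrow> (MOST n. Q \<chi> n (loc l n) (x n))"
    if "l \<in> lists X'" "h_formula L \<chi>" "x \<in> prod_univ M" for l \<chi> x
  proof -
    let ?u = "(\<lambda>v. rep (env l v))(0 := x)"
    have u: "?u v \<in> prod_univ M" for v using env_rep[OF that(1)] that(3) by simp
    have "(env l)(0 := cls x) = (\<lambda>v. cls (?u v))" using env_rep[OF that(1)] by (simp add: fun_eq_iff)
    moreover have "(\<lambda>v. ?u v n) = (loc l n)(0 := x n)" for n by (simp add: loc_def fun_eq_iff)
    ultimately show ?thesis
      using h_formula_Los[OF that(2) u] that(3) by (simp add: inst_def Q_def univ_R)
  qed

  \<comment> \<open>The instances of members of \<open>H\<close> that lie in \<open>U\<close> are to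
    be realised and the others avoided; \<open>fin\<close> obtains this for finitely many at a time
    from \<open>witness\<close>.\<close>
  define Pos where "Pos = (\<lambda>(\<chi>, l). (\<chi>, loc l)) ` {(\<chi>, l). \<chi> \<in> H \<and> l \<in> lists X' \<and> inst \<chi> l \<in> U}"
  define Neg where "Neg = (\<lambda>(\<chi>, l). (\<chi>, loc l)) ` {(\<chi>, l). \<chi> \<in> H \<and> l \<in> lists X' \<and> inst \<chi> l \<notin> U}"
  have H_h: "h_formula L \<chi>" if "\<chi> \<in> H" for \<chi> using that by (simp add: H_def)
  have fin: "\<exists>x\<in>prod_univ M. (\<forall>(\<chi>, b)\<in>P. MOST n. Q \<chi> n (b n) (x n)) \<and>
      (\<forall>(\<chi>, b)\<in>N. \<not> (MOST n. Q \<chi> n (b n) (x n)))"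
    if P: "finite P" "P \<subseteq> Pos" and N: "finite N" "N \<subseteq> Neg" for P N
  proof -
    obtain P' where "P' \<subseteq> {(\<chi>, l). \<chi> \<in> H \<and> l \<in> lists X' \<and> inst \<chi> l \<in> U} \<and>
        finite P' \<and> P = (\<lambda>(\<chi>, l). (\<chi>, loc l)) ` P'"
      using finite_subset_image[OF P(1) P(2)[unfolded Pos_def]] ..
    then have P': "finite P'" "P' \<subseteq> {(\<chi>, l). \<chi> \<in> H \<and> l \<in> lists X' \<and> inst \<chi> l \<in> U}"
        "P = (\<lambda>(\<chi>, l). (\<chi>, loc l)) ` P'"
      by (simp_all only:)
    obtain N' where "N' \<subseteq> {(\<chi>, l). \<chi> \<in> H \<and> l \<in> lists X' \<and> inst \<chi> l \<notin> U} \<and>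
        finite N' \<and> N = (\<lambda>(\<chi>, l). (\<chi>, loc l)) ` N'"
      using finite_subset_image[OF N(1) N(2)[unfolded Neg_def]] ..
    then have N': "finite N'" "N' \<subseteq> {(\<chi>, l). \<chi> \<in> H \<and> l \<in> lists X' \<and> inst \<chi> l \<notin> U}"
        "N = (\<lambda>(\<chi>, l). (\<chi>, loc l)) ` N'"
      by (simp_all only:)
    have "\<exists>a\<in>univ R. (\<forall>Y\<in>case_prod inst ` P'. a \<in> Y) \<and> (\<forall>Y\<in>case_prod inst ` N'. a \<notin> Y)"
      by (rule witness) (use P'(1,2) N'(1,2) in auto)
    then obtain x where x: "x \<in> prod_univ M" "\<forall>Y\<in>case_prod inst ` P'. cls x \<in> Y"
        "\<forall>Y\<in>case_prod inst ` N'. cls x \<notin> Y"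
      unfolding univ_R by blast
    have "MOST n. Q \<chi> n (loc l n) (x n)" if "(\<chi>, l) \<in> P'" for \<chi> l
    proof -
      have "cls x \<in> inst \<chi> l" using x(2) that by force
      then show ?thesis using inst_iff[of l \<chi> x] x(1) P'(2) that H_h by auto
    qed
    moreover have "\<not> (MOST n. Q \<chi> n (loc l n) (x n))" if "(\<chi>, l) \<in> N'" for \<chi> l
    proof -
      have "cls x \<notin> inst \<chi> l" using x(3) that by force
      moreover have "l \<in> lists X'" "h_formula L \<chi>" using N'(2) that H_h by auto
      ultimately show ?thesis using inst_iff[of l \<chi> x] x(1) by metis
    qed
    ultimately show ?thesis using x(1) unfolding P'(3) N'(3) by (intro bexI[of _ x]) (simp_all add: split_beta)
  qed
  have "|Neg| \<le>o |H \<times> lists X'|"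
    unfolding Neg_def by (rule surj_imp_ordLeq[OF image_mono]) auto
  then have card_Neg: "|Neg| <o continuum"
    by (rule ordLeq_ordLess_trans[OF _ card_of_countable_Times_lists_ordLess_continuum[OF H card_X']])
  have prod: "prod_univ M = (\<Pi> n\<in>UNIV. A n)" by (simp add: prod_univ_def A_def)
  have "\<exists>x\<in>(\<Pi> n\<in>UNIV. A n). (\<forall>(\<chi>, b)\<in>Pos. MOST n. Q \<chi> n (b n) (x n)) \<and>
      (\<forall>(\<chi>, b)\<in>Neg. INFM n. \<not> Q \<chi> n (b n) (x n))"
  proof (rule realise_normal_predicates[OF H _ _ _ card_Neg])
    fix \<psi> assume "\<psi> \<in> H"
    then obtain e where "h_formula L \<psi>" "range e \<subseteq> univ R" "sat R e \<psi>" by (auto simp: H_def)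
    from h_formula_normal[OF stable this]
    show "MOST n. \<forall>c\<in>A n. \<forall>d\<in>A n. \<forall>\<beta>\<in>B n. \<forall>\<gamma>\<in>B n.
        Q \<psi> n \<beta> c \<longrightarrow> Q \<psi> n \<gamma> c \<longrightarrow> Q \<psi> n \<beta> d \<longrightarrow> Q \<psi> n \<gamma> d"
      unfolding A_def B_def Q_def .
  next
    show "Pos \<subseteq> H \<times> (\<Pi> n\<in>UNIV. B n)" "Neg \<subseteq> H \<times> (\<Pi> n\<in>UNIV. B n)"
      unfolding Pos_def Neg_def using loc by auto
  next
    fix P assume "finite P" "P \<subseteq> Pos"
    from fin[OF this, of "{}"]
    show "\<exists>x\<in>(\<Pi> n\<in>UNIV. A n). \<forall>(\<psi>, b)\<in>P. MOST n. Q \<psi> n (b n) (x n)"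
      unfolding prod by simp
  next
    fix P \<psi> b assume "finite P" "P \<subseteq> Pos" "(\<psi>, b) \<in> Neg"
    from fin[OF this(1,2), of "{(\<psi>, b)}"] this(3)
    show "\<exists>x\<in>(\<Pi> n\<in>UNIV. A n). (\<forall>(\<psi>, b)\<in>P. MOST n. Q \<psi> n (b n) (x n)) \<and>
        (INFM n. \<not> Q \<psi> n (b n) (x n))"
      unfolding prod by simp
  qed
  then obtain x where x: "x \<in> prod_univ M" "\<forall>(\<chi>, b)\<in>Pos. MOST n. Q \<chi> n (b n) (x n)"
      "\<forall>(\<chi>, b)\<in>Neg. INFM n. \<not> Q \<chi> n (b n) (x n)"
    unfolding prod[symmetric] by blast
  have x_univ: "cls x \<in> univ R" using x(1) by (simp add: univ_R)

  \<comment> \<open>From h-formulas to all formulas of the type\<close>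
  have decided: "cls x \<in> inst \<chi> l \<longleftrightarrow> inst \<chi> l \<in> U" if "h_formula L \<chi>" "l \<in> lists X'" for \<chi> l
  proof (cases "\<chi> \<in> H")
    case True
    have iff: "cls x \<in> inst \<chi> l \<longleftrightarrow> (MOST n. Q \<chi> n (loc l n) (x n))"
      by (rule inst_iff[OF that(2,1) x(1)])
    show ?thesis
    proof (cases "inst \<chi> l \<in> U")
      case True
      then have "(\<chi>, loc l) \<in> Pos" using \<open>\<chi> \<in> H\<close> that(2) unfolding Pos_def by force
      then have "MOST n. Q \<chi> n (loc l n) (x n)" using x(2) by blast
      then show ?thesis using True iff by simp
    next
      case False
      then have "(\<chi>, loc l) \<in> Neg" using \<open>\<chi> \<in> H\<close> that(2) unfolding Neg_def by force
      then have "INFM n. \<not> Q \<chi> n (loc l n) (x n)" using x(3) by blast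
      then have "\<not> (MOST n. Q \<chi> n (loc l n) (x n))" by simp
      then show ?thesis using False iff by metis
    qed
  next
    \<comment> \<open>Members of \<open>H\<close> are satisfiable, as normality requires. An
      h-formula outside \<open>H\<close> has empty instances, which \<open>U\<close> cannot
      contain.\<close>
    case False
    have "\<not> sat R ((env l)(0 := a)) \<chi>" if "a \<in> univ R" for a
    proof -
      have "range ((env l)(0 := a)) \<subseteq> univ R"
        using env[OF \<open>l \<in> lists X'\<close>] that by (auto simp: image_subset_iff)
      then show ?thesis using False \<open>h_formula L \<chi>\<close> unfolding H_def by blast
    qed
    then have "inst \<chi> l = {}" by (simp add: inst_def)
    moreover have "{} \<notin> U" using fip[of "{{}}"] by auto
    ultimately show ?thesis by simp
  qed
  have "sat R (\<lambda>_. cls x) \<phi>" if "\<phi> \<in> p" for \<phi>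
  proof -
    have \<phi>: "fm_wf L \<phi>" "fm_params \<phi> \<subseteq> X'" "fm_vars \<phi> \<subseteq> {0}"
      using p that X'(3) unfolding is_type_def by blast+
    obtain \<phi>' :: "('f, 'r, (nat \<Rightarrow> 'a) set) fm" and l where
      \<phi>': "fm_wf L \<phi>'" "fm_params \<phi>' = {}" and l: "l \<in> lists X'"
      and sat: "\<And>(M :: ('f, 'r, (nat \<Rightarrow> 'a) set) struct) a.
        sat M (\<lambda>_. a) \<phi> \<longleftrightarrow> sat M ((list_env d l)(0 := a)) \<phi>'"
      by (rule parameters_as_variables[OF \<phi>(1,2) X'(2) \<phi>(3)]) blast
    obtain G where G: "finite G" "\<forall>\<chi>\<in>G. h_formula L \<chi>" "determines G \<phi>'"
      using determined_by_h_formulas[OF \<phi>'] by blast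
    define Y where "Y = {a\<in>univ R. sat R (\<lambda>_. a) \<phi>}"
    have "Y \<in> U" using F that unfolding F_def Y_def by blast
    \<comment> \<open>\<open>a\<close> satisfies \<open>\<phi>\<close> and follows the decisions of
      \<open>U\<close> on the finite set \<open>G\<close>. So does \<open>cls x\<close> by
      \<open>decided\<close>, and \<open>G\<close> determines \<open>\<phi>'\<close>; hence
      \<open>cls x\<close> satisfies \<open>\<phi>\<close> as well.\<close>
    have "\<exists>a\<in>univ R. (\<forall>Z\<in>insert Y ((\<lambda>\<chi>. inst \<chi> l) ` {\<chi>\<in>G. inst \<chi> l \<in> U}). a \<in> Z) \<and>
        (\<forall>Z\<in>(\<lambda>\<chi>. inst \<chi> l) ` {\<chi>\<in>G. inst \<chi> l \<notin> U}. a \<notin> Z)"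
      by (rule witness) (use G(1) \<open>Y \<in> U\<close> in auto)
    then obtain a where a: "a \<in> univ R"
        and pos: "\<forall>Z\<in>insert Y ((\<lambda>\<chi>. inst \<chi> l) ` {\<chi>\<in>G. inst \<chi> l \<in> U}). a \<in> Z"
        and neg: "\<forall>Z\<in>(\<lambda>\<chi>. inst \<chi> l) ` {\<chi>\<in>G. inst \<chi> l \<notin> U}. a \<notin> Z"
      by (elim bexE conjE)
    have inst_a: "a \<in> inst \<chi> l \<longleftrightarrow> inst \<chi> l \<in> U" if "\<chi> \<in> G" for \<chi>
      using pos neg that by (cases "inst \<chi> l \<in> U") auto
    have "sat R ((env l)(0 := a)) \<phi>' \<longleftrightarrow> sat R ((env l)(0 := cls x)) \<phi>'"
    proof (rule determinesD[OF G(3)])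
      show "range ((env l)(0 := a)) \<subseteq> univ R" "range ((env l)(0 := cls x)) \<subseteq> univ R"
        using env[OF l] a x_univ by (auto simp: image_subset_iff)
      show "sat R ((env l)(0 := a)) \<chi> \<longleftrightarrow> sat R ((env l)(0 := cls x)) \<chi>" if "\<chi> \<in> G" for \<chi>
      proof -
        have "a \<in> inst \<chi> l \<longleftrightarrow> cls x \<in> inst \<chi> l" using inst_a[OF that] decided[OF _ l] G(2) that by metis
        then show ?thesis using a x_univ by (simp add: inst_def)
      qed
    qed
    moreover have "sat R (\<lambda>_. a) \<phi>" using pos by (simp add: Y_def)
    ultimately show ?thesis unfolding sat env_def by blast
  qed
  then show "\<exists>a. realises R a p" using x_univ unfolding realises_def by blast
qed

text \<open>A sequence of binary sequences is coded by one binary sequence through pairing of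
  natural numbers, so the product has at most continuum many elements, and \<open>R\<close> is an
  image of it.\<close>

lemma card_of_univ_R:
  assumes "\<And>n. |univ (M n)| \<le>o continuum"
  shows "|univ R| \<le>o continuum"
proof -
  have "|univ (M n)| \<le>o |UNIV :: (nat \<Rightarrow> bool) set|" for n
    using assms continuum_ordIso by (rule ordLeq_ordIso_trans)
  then have "\<forall>n. \<exists>g :: 'a \<Rightarrow> nat \<Rightarrow> bool. inj_on g (univ (M n))"
    unfolding card_of_ordLeq[symmetric] by blast
  from choice[OF this] obtain g :: "nat \<Rightarrow> 'a \<Rightarrow> nat \<Rightarrow> bool" where
    g: "\<forall>n. inj_on (g n) (univ (M n))" ..
  define h where "h x k = g (fst (prod_decode k)) (x (fst (prod_decode k))) (snd (prod_decode k))"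
    for x :: "nat \<Rightarrow> 'a" and k
  have "inj_on h (prod_univ M)"
  proof (rule inj_onI, rule ext)
    fix x y n assume x: "x \<in> prod_univ M" and y: "y \<in> prod_univ M" and "h x = h y"
    then have "h x (prod_encode (n, j)) = h y (prod_encode (n, j))" for j by (simp only:)
    then have "g n (x n) = g n (y n)" by (simp add: h_def fun_eq_iff)
    moreover have "x n \<in> univ (M n)" "y n \<in> univ (M n)" using x y by (auto simp: prod_univ_def)
    ultimately show "x n = y n" using g by (auto dest: inj_onD)
  qed
  then have "|prod_univ M| \<le>o |UNIV :: (nat \<Rightarrow> bool) set|" by (intro card_of_ordLeqI) simp_all
  moreover have "|univ R| \<le>o |prod_univ M|" unfolding univ_R by (rule card_of_image)
  ultimately have "|univ R| \<le>o |UNIV :: (nat \<Rightarrow> bool) set|" by (rule ordLeq_transitive[rotated])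
  then show ?thesis using ordIso_symmetric[OF continuum_ordIso] by (rule ordLeq_ordIso_trans)
qed

end

theorem theorem1:
  fixes L :: "('f, 'r) language"
    and M :: "nat \<Rightarrow> ('f, 'r, 'a) struct"
  assumes "countable_language L"
    and "\<And>n. is_struct L (M n)"
    and "stable L (Th L (reduced_product Fin M))"
  shows "card_saturated L continuum (reduced_product Fin M) \<and>
         ((\<forall>n. |univ (M n)| \<le>o continuum) \<longrightarrow> saturated L (reduced_product Fin M))"
proof (intro conjI impI)
  interpret fin_reduced_product L M by unfold_locales (rule assms(2))
  show sat: "card_saturated L continuum (reduced_product Fin M)"
    by (rule card_saturated_continuum[OF assms(1,3)])
  assume "\<forall>n. |univ (M n)| \<le>o continuum"
  then have "|univ (reduced_product Fin M)| \<le>o continuum" by (intro card_of_univ_R) simp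
  \<comment> \<open>Every parameter set smaller than the product is also smaller than the continuum,
    so the first part applies to it.\<close>
  then have "|X| <o continuum" if "|X| <o |univ (reduced_product Fin M)|" for X :: "(nat \<Rightarrow> 'a) set set"
    using that by (rule ordLess_ordLeq_trans[rotated])
  then show "saturated L (reduced_product Fin M)"
    using sat unfolding saturated_def card_saturated_def by blast
qed

end
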